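(* Let $M\ge 0$ be a fixed integer and let the positions $X_1,\dots,X_M$ of the interferers be independent and uniformly distributed over the disk $\mathcal A$ of radius $r_{\mathsf{out}}$ centered at the origin, with common access probability $p_i=p\in[0,1]$ for all $i$. Then for each $j\in\{1,2\}$ the spatially averaged second moment of the conditional outage probability $\epsilon_j(\boldsymbol r)$ is $$\mathbb E_{\boldsymbol r}[\epsilon_j^2(\boldsymbol r)\mid M]=2\,\mathbb E_{\boldsymbol r}[\epsilon_j(\boldsymbol r)\mid M]-1+\exp\left(-\frac{2\beta}{\mathsf{SNR}}\right)\mathcal S(r_{\mathsf{out}},r_0)^M,$$ where $$\mathcal S(r_{\mathsf{out}},r_0)=(1-p)^2+\frac{4r_0^2}{|\mathcal A|}(1-p)p\left[\frac{\pi}{\beta}\Psi\left(\frac{r_{\mathsf{out}}-r_0}{r_0}\right)+\mathcal Z_1(r_{\mathsf{out}},r_0)\right]+\frac{2r_0^2p^2}{|\mathcal A|}\left[\pi\,\mathcal G\left(\frac{r_{\mathsf{out}}-r_0}{r_0}\right)+\mathcal Z_2(r_{\mathsf{out}},r_0)\right],$$ $$\Psi(x)=\int_0^x\frac{r^{\alpha+1}}{1+r^\alpha\beta^{-1}}\,dr=\frac{x^{\alpha+2}}{2+\alpha}\;{}_2F_1\left(1,\tfrac{2}{\alpha}+1;\tfrac{2}{\alpha}+2;-\tfrac{x^\alpha}{\beta}\right),$$ $$\mathcal G(x)=\int_0^x\frac{r^{2\alpha+1}}{(\beta+r^\alpha)^2}\,dr=\frac{x^{2\alpha+2}}{(2+2\alpha)\beta^2}\;{}_2F_1\left(2,\tfrac{2+2\alpha}{\alpha};\tfrac{2+3\alpha}{\alpha};-\tfrac{x^\alpha}{\beta}\right),$$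 $$\mathcal Z_k(x,y)=\int_{(x-y)/y}^{(x+y)/y}\frac{r^{k\alpha+1}}{(\beta+r^\alpha)^k}\arccos\left(\frac{y^2r^2+y^2-x^2}{2y^2r}\right)dr\qquad(k=1,2).$$
   Context: Network model. Identify the plane with $\mathbb C$. The network region $\mathcal A$ is the disk of radius $r_{\mathsf{out}}$ centered at $0$, with area $|\mathcal A|=\pi r_{\mathsf{out}}^2$. A reference transmitter is at $X_0=0$; two receivers are at $Y_1=r_0$ and $Y_2=r_0e^{\mathrm{i}\theta}$, where $0<r_0\le r_{\mathsf{out}}$, $\theta\in\mathbb R$. There are $M$ interferers at positions $X_1,\dots,X_M\in\mathcal A$. Put $r_{i,j}=|X_i-Y_j|/r_0$ (normalized distance) and $\boldsymbol r=\{r_{i,j}\}_{1\le i\le M,\,j\in\{1,2\}}$. Constants: path-loss exponent $\alpha>0$, SINR threshold $\beta>0$, $\mathsf{SNR}>0$. The SINR at $Y_j$ is $$\gamma_j=\frac{g_{0,j}}{\mathsf{SNR}^{-1}+\sum_{i=1}^M I_i\,g_{i,j}\,r_{i,j}^{-\alpha}},$$ where the $g_{i,j}$ are i.i.d. unit-mean exponential random variables (Rayleigh fading), the $I_i$ are independent Bernoulli variables with $\mathbb P[I_i=1]=p_i$, and the $g$'s, the $I$'s and the positions are mutually independent. The conditional outage probability is $$\epsilon_j(\boldsymbol r)=\mathbb P[\gamma_j\le\beta\mid\boldsymbol r,M]=1-\exp\left(-\frac{\beta}{\mathsf{SNR}}\right)\prod_{i=1}^M\left(1-p_i+\frac{p_i\,r_{i,j}^\alpha}{\beta+r_{i,j}^\alpha}\right).$$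 $\mathbb E_{\boldsymbol r}[\,\cdot\mid M]$ denotes expectation over the interferer positions for the given number $M$. ${}_2F_1$ is the Gauss hypergeometric function. *)

theory Defs
  imports "HOL-Probability.Probability" "HOL-Complex_Analysis.Complex_Analysis"
begin

section \<open>The Gauss hypergeometric function\<close>

text \<open>
  The principal branch: the analytic continuation of the Gauss series from the unit disk to the
  plane cut along the real ray from 1 to infinity. The series alone is not enough here, since the
  argument \<open>- x powr \<alpha> / \<beta>\<close> leaves the unit disk when \<open>x\<close> is large.
\<close>

definition slit_plane :: "complex set" where
  "slit_plane = - complex_of_real ` {1..}"

definition hyp2F1 :: "complex \<Rightarrow> complex \<Rightarrow> complex \<Rightarrow> complex \<Rightarrow> complex" where
  "hyp2F1 a b c z =
     (THE w. \<exists>F. F holomorphic_on slit_plane \<and>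
                 (\<forall>u\<in>ball 0 1. F u = eval_fps (fps_hypergeo [a, b] [c] 1) u) \<and> w = F z)"

lemma gauss_series_nth:
  "fps_nth (fps_hypergeo [a, b] [c] (1::complex)) n =
     pochhammer a n * pochhammer b n / (pochhammer c n * fact n)"
  by simp

lemma open_slit_plane: "open slit_plane"
proof -
  have "complex_of_real ` {1..} = {z. Im z = 0} \<inter> {z. 1 \<le> Re z}"
    by (auto simp: complex_eq_iff image_iff intro!: bexI[where x = "Re _"])
  then have "closed (complex_of_real ` {1..})"
    by (auto intro!: closed_Collect_eq closed_Collect_le continuous_intros)
  then show ?thesis
    by (simp add: slit_plane_def open_Compl)
qed

lemma connected_slit_plane: "connected slit_plane"
proof (rule starlike_imp_connected)
  show "starlike slit_plane"
    unfolding starlike_def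
  proof (intro bexI[of _ "0::complex"] ballI subsetI)
    show "0 \<in> slit_plane"
      by (auto simp: slit_plane_def)
  next
    fix z w :: complex
    assume z: "z \<in> slit_plane" and "w \<in> closed_segment 0 z"
    then obtain t where t: "0 \<le> t" "t \<le> 1" "w = t *\<^sub>R z"
      by (auto simp: in_segment)
    show "w \<in> slit_plane"
    proof (rule ccontr)
      assume "w \<notin> slit_plane"
      then obtain x where x: "x \<ge> 1" "w = complex_of_real x"
        by (auto simp: slit_plane_def)
      with t have "t > 0"
        by (cases "t = 0") auto
      with t x have "z = complex_of_real (x / t)"
        by (auto simp: scaleR_conv_of_real field_simps)
      moreover have "x / t \<ge> 1"
        using \<open>t > 0\<close> t x by (simp add: field_simps)
      ultimately show False
        using z by (auto simp del: of_real_divide simp: slit_plane_def)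
    qed
  qed
qed

lemma hyp2F1_eqI:
  assumes "F holomorphic_on slit_plane"
    and "\<And>u. norm u < 1 \<Longrightarrow> F u = eval_fps (fps_hypergeo [a, b] [c] 1) u"
    and "z \<in> slit_plane"
  shows "hyp2F1 a b c z = F z"
  unfolding hyp2F1_def
proof (rule the_equality)
  show "\<exists>G. G holomorphic_on slit_plane \<and>
      (\<forall>u\<in>ball 0 1. G u = eval_fps (fps_hypergeo [a, b] [c] 1) u) \<and> F z = G z"
    using assms by (intro exI[of _ F]) auto
next
  have sub: "ball 0 1 \<subseteq> slit_plane"
    by (auto simp: slit_plane_def)
  fix w
  assume "\<exists>G. G holomorphic_on slit_plane \<and>
      (\<forall>u\<in>ball 0 1. G u = eval_fps (fps_hypergeo [a, b] [c] 1) u) \<and> w = G z"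
  then obtain G where G: "G holomorphic_on slit_plane"
      "\<forall>u\<in>ball 0 1. G u = eval_fps (fps_hypergeo [a, b] [c] 1) u" "w = G z"
    by blast
  have "G z = F z"
    by (rule analytic_continuation_open[OF _ open_slit_plane _ connected_slit_plane sub])
       (use G assms in auto)
  with G show "w = F z"
    by simp
qed


section \<open>The network model\<close>

definition receiver :: "real \<Rightarrow> real \<Rightarrow> nat \<Rightarrow> complex" where
  "receiver r0 \<theta> j = (if j = 1 then complex_of_real r0 else complex_of_real r0 * cis \<theta>)"

definition norm_dist :: "real \<Rightarrow> real \<Rightarrow> (nat \<Rightarrow> 'w \<Rightarrow> complex) \<Rightarrow> nat \<Rightarrow> nat \<Rightarrow> 'w \<Rightarrow> real" where
  "norm_dist r0 \<theta> X i j \<omega> = norm (X i \<omega> - receiver r0 \<theta> j) / r0"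

text \<open>
  Index 0 is the reference transmitter, whose normalized distance to both receivers is 1.
  Where an active interferer sits exactly on the receiver, \<open>0 powr (- \<alpha>) = 0\<close> rather than
  infinity; for uniformly distributed positions this is a null event.
\<close>

definition sinr :: "real \<Rightarrow> real \<Rightarrow> real \<Rightarrow> real \<Rightarrow> (nat \<Rightarrow> 'w \<Rightarrow> complex) \<Rightarrow>
    (nat \<Rightarrow> nat \<Rightarrow> 'w \<Rightarrow> real) \<Rightarrow> (nat \<Rightarrow> 'w \<Rightarrow> bool) \<Rightarrow> nat \<Rightarrow> nat \<Rightarrow> 'w \<Rightarrow> real" where
  "sinr snr \<alpha> r0 \<theta> X g act M j \<omega> =
     g 0 j \<omega> / (1 / snr + (\<Sum>i=1..M. of_bool (act i \<omega>) * g i j \<omega> * norm_dist r0 \<theta> X i j \<omega> powr (- \<alpha>)))"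

definition dist_algebra :: "'w measure \<Rightarrow> real \<Rightarrow> real \<Rightarrow> (nat \<Rightarrow> 'w \<Rightarrow> complex) \<Rightarrow> nat \<Rightarrow> 'w measure" where
  "dist_algebra \<Omega> r0 \<theta> X M =
     vimage_algebra (space \<Omega>)
       (\<lambda>\<omega>. \<lambda>(i, j)\<in>{1..M} \<times> {1, 2}. norm_dist r0 \<theta> X i j \<omega>)
       (Pi\<^sub>M ({1..M} \<times> {1, 2}) (\<lambda>_. borel))"

text \<open>
  The conditional outage probability, as a random variable: the conditional expectation of the
  indicator of the outage event given the sigma-algebra generated by all normalized distances.
\<close>

definition outage :: "'w measure \<Rightarrow> real \<Rightarrow> real \<Rightarrow> real \<Rightarrow> real \<Rightarrow> real \<Rightarrow> (nat \<Rightarrow> 'w \<Rightarrow> complex) \<Rightarrow>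
    (nat \<Rightarrow> nat \<Rightarrow> 'w \<Rightarrow> real) \<Rightarrow> (nat \<Rightarrow> 'w \<Rightarrow> bool) \<Rightarrow> nat \<Rightarrow> nat \<Rightarrow> 'w \<Rightarrow> real" where
  "outage \<Omega> snr \<alpha> \<beta> r0 \<theta> X g act M j =
     real_cond_exp \<Omega> (dist_algebra \<Omega> r0 \<theta> X M)
       (indicator {\<omega> \<in> space \<Omega>. sinr snr \<alpha> r0 \<theta> X g act M j \<omega> \<le> \<beta>})"

text \<open>
  Mutual independence of the positions, fading gains and access indicators. As these take values in
  three different types, the library's independence of a family of random variables (which share a
  value type) is replaced by what it unfolds to: independence of the generated families of events.
\<close>

datatype source = Pos nat | Fading nat nat | Access nat

primrec source_events :: "'w measure \<Rightarrow> (nat \<Rightarrow> 'w \<Rightarrow> complex) \<Rightarrow>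
    (nat \<Rightarrow> nat \<Rightarrow> 'w \<Rightarrow> real) \<Rightarrow> (nat \<Rightarrow> 'w \<Rightarrow> bool) \<Rightarrow> source \<Rightarrow> 'w set set" where
  "source_events \<Omega> X g act (Pos i) = {X i -` A \<inter> space \<Omega> | A. A \<in> sets borel}"
| "source_events \<Omega> X g act (Fading i j) = {g i j -` A \<inter> space \<Omega> | A. A \<in> sets borel}"
| "source_events \<Omega> X g act (Access i) = {act i -` A \<inter> space \<Omega> | A. A \<in> sets (count_space UNIV)}"

definition sources :: "nat \<Rightarrow> source set" where
  "sources M = Pos ` {1..M} \<union> {Fading i j | i j. i \<in> {0..M} \<and> j \<in> {1, 2}} \<union> Access ` {1..M}"


section \<open>The auxiliary functions\<close>

definition Psi :: "real \<Rightarrow> real \<Rightarrow> real \<Rightarrow> real" where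
  "Psi \<alpha> \<beta> x = integral {0..x} (\<lambda>r. r powr (\<alpha> + 1) / (1 + r powr \<alpha> * inverse \<beta>))"

definition G_fun :: "real \<Rightarrow> real \<Rightarrow> real \<Rightarrow> real" where
  "G_fun \<alpha> \<beta> x = integral {0..x} (\<lambda>r. r powr (2 * \<alpha> + 1) / (\<beta> + r powr \<alpha>)\<^sup>2)"

definition Z_fun :: "real \<Rightarrow> real \<Rightarrow> nat \<Rightarrow> real \<Rightarrow> real \<Rightarrow> real" where
  "Z_fun \<alpha> \<beta> k x y = integral {(x - y) / y..(x + y) / y}
     (\<lambda>r. r powr (real k * \<alpha> + 1) / (\<beta> + r powr \<alpha>) ^ k *
          arccos ((y\<^sup>2 * r\<^sup>2 + y\<^sup>2 - x\<^sup>2) / (2 * y\<^sup>2 * r)))"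

definition S_fun :: "real \<Rightarrow> real \<Rightarrow> real \<Rightarrow> real \<Rightarrow> real \<Rightarrow> real" where
  "S_fun \<alpha> \<beta> p rout r0 =
     (let area = pi * rout\<^sup>2 in
       (1 - p)\<^sup>2
       + 4 * r0\<^sup>2 / area * (1 - p) * p *
           (pi / \<beta> * Psi \<alpha> \<beta> ((rout - r0) / r0) + Z_fun \<alpha> \<beta> 1 rout r0)
       + 2 * r0\<^sup>2 * p\<^sup>2 / area *
           (pi * G_fun \<alpha> \<beta> ((rout - r0) / r0) + Z_fun \<alpha> \<beta> 2 rout r0))"

end

theory Submission
  imports Defs
begin

text \<open>
  Given the distances, the event of success asks an exponential gain to exceed an independent
  nonnegative threshold; integrating this gain out turns the conditional success probability into a
  product over the interferers. Its square has mean \<open>exp (- 2 * \<beta> / snr)\<close> times the \<open>M\<close>-th power of the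
  second moment of a single factor, and expanding \<open>(1 - \<epsilon>)\<^sup>2\<close> gives the claim.

  The single-factor moments are averages over the disk of a function of the distance to the receiver.
  As Lebesgue measure is rotation invariant, the receiver may be replaced by a uniformly rotated copy
  of itself; then only the radial distribution of the norm and the opening angle of an arc enter, and
  no change of variables to polar coordinates is needed.

  The hypergeometric forms come from the Euler-type integral
  \<open>c * integral {0..1} (\<lambda>s. s powr (c - 1) / (1 - s powr \<alpha> * z) ^ k)\<close>, which is holomorphic on the
  slit plane and expands to the Gauss series in the unit disk.
\<close>

section \<open>An Euler integral for the hypergeometric function\<close>

text \<open>A conditional expectation is fixed only almost everywhere, so the product formula is
  tested against events of the distance vector, with the positions frozen; they are independent of
  gains and access indicators. The disk is seen from an off-centre receiver. The circle of
  normalized radius \<open>r\<close> about it stays inside up to \<open>(rout - r0) / r0\<close>,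
  where the full angle 2 pi gives the terms \<open>Psi\<close> and \<open>G_fun\<close>. It then
  crosses the boundary, where the law of cosines gives twice the arccos of \<open>Z_fun\<close>;
  beyond \<open>(rout + r0) / r0\<close> it misses the disk. The lower hypergeometric parameter
  exceeds the second upper one, \<open>b = c / \<alpha>\<close>, by 1 because each term of the
  series integrates a single power, which leaves a factor proportional to
  \<open>1 / (b + n)\<close>. With \<open>s\<close> the conditional success probability,
  \<open>(1 - s)\<^sup>2 = 2 * (1 - s) - 1 + s\<^sup>2\<close>: the mean outage stays in the answer,
  so only the mean of \<open>s\<^sup>2\<close> has to be evaluated.\<close>

lemma one_minus_scaled_nonzero:
  fixes z :: complex and t :: real
  assumes "z \<in> slit_plane" "0 \<le> t" "t \<le> 1"
  shows "1 - complex_of_real t * z \<noteq> 0"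
proof
  assume "1 - complex_of_real t * z = 0"
  then have *: "complex_of_real t * z = 1" by simp
  then have "t \<noteq> 0" by auto
  with * have "z = complex_of_real (1 / t)" by (simp add: field_simps)
  moreover have "1 / t \<ge> 1" using assms \<open>t \<noteq> 0\<close> by simp
  ultimately show False using assms(1) unfolding slit_plane_def by (auto simp del: of_real_divide)
qed

text \<open>Under \<open>t = s powr \<alpha>\<close> this is Euler's integrand
  \<open>t powr (b - 1) / (1 - t * z) ^ k\<close> with \<open>b = c / \<alpha>\<close>; the Jacobian
  turns Euler's prefactor \<open>b\<close> into \<open>c\<close>. In the variable \<open>s\<close>
  the radial integrals match by scaling alone.\<close>

definition euler_integrand :: "real \<Rightarrow> real \<Rightarrow> nat \<Rightarrow> complex \<Rightarrow> real \<Rightarrow> complex" where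
  "euler_integrand \<alpha> c k z s =
     complex_of_real (s powr (c - 1)) / (1 - complex_of_real (s powr \<alpha>) * z) ^ k"

lemma powr_unit_le_1: "s powr a \<le> 1" if "0 \<le> s" "s \<le> 1" "0 \<le> a" for s a :: real
  using powr_mono2[of a s 1] that by simp

lemma continuous_on_powr_nonneg:
  fixes f :: "'a :: topological_space \<Rightarrow> real"
  assumes "continuous_on A f" "\<And>x. x \<in> A \<Longrightarrow> 0 \<le> f x" "0 < a"
  shows "continuous_on A (\<lambda>x. f x powr a)"
  using assms by (intro continuous_on_powr' continuous_on_const) auto

text \<open>Since \<open>c > 1\<close>, the numerator is continuous at 0 as well, so no improper
  integral arises.\<close>

lemma continuous_on_euler_integrand:
  assumes "0 < \<alpha>" "1 < c" "z \<in> slit_plane"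
  shows "continuous_on {0..1} (euler_integrand \<alpha> c k z)"
proof -
  have "1 - complex_of_real (s powr \<alpha>) * z \<noteq> 0" if "s \<in> {0..1}" for s
    using that assms by (intro one_minus_scaled_nonzero powr_unit_le_1) auto
  then show ?thesis
    unfolding euler_integrand_def
    by (intro continuous_on_powr_nonneg continuous_intros) (use assms in auto)
qed

lemma holomorphic_euler_integral:
  assumes "0 < \<alpha>" "1 < c"
  shows "(\<lambda>z. integral {0..1} (euler_integrand \<alpha> c k z)) holomorphic_on slit_plane"
proof -
  \<comment> \<open>The Leibniz rule used here asks for a convex domain, which the slit plane is
    not. Holomorphy is local, so balls inside it suffice.\<close>
  have loc: "(\<lambda>z. integral {0..1} (euler_integrand \<alpha> c k z)) holomorphic_on U"
    if U: "U \<subseteq> slit_plane" "convex U" for U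
  proof -
    define D where "D = (\<lambda>z s. complex_of_real (s powr (c - 1)) * (of_nat k * complex_of_real (s powr \<alpha>)) /
        (1 - complex_of_real (s powr \<alpha>) * z) ^ Suc k)"
    have nz: "1 - complex_of_real (s powr \<alpha>) * z \<noteq> 0" if "z \<in> U" "s \<in> {0..1}" for z s
      using that U assms by (intro one_minus_scaled_nonzero powr_unit_le_1) auto
    have "(\<lambda>z. integral (cbox 0 1) (euler_integrand \<alpha> c k z)) holomorphic_on U"
    proof (rule leibniz_rule_holomorphic[where fx = D])
      fix z s assume z: "z \<in> U" and s: "s \<in> cbox (0::real) 1"
      then have n: "1 - complex_of_real (s powr \<alpha>) * z \<noteq> 0" using nz by auto
      show "((\<lambda>z. euler_integrand \<alpha> c k z s) has_field_derivative D z s) (at z within U)"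
      proof (cases k)
        case 0
        then show ?thesis by (simp add: euler_integrand_def D_def)
      next
        case (Suc m)
        define w where "w = complex_of_real (s powr \<alpha>)"
        define A where "A = complex_of_real (s powr (c - 1))"
        have w: "1 - w * z \<noteq> 0" using n by (simp add: w_def)
        then have "((\<lambda>z. inverse (1 - w * z)) has_field_derivative w * inverse (1 - w * z) ^ 2) (at z within U)"
          by (auto intro!: derivative_eq_intros simp: power2_eq_square)
        from DERIV_cmult[OF DERIV_power_Suc[OF this, of m], of A]
        have "((\<lambda>z. A * inverse (1 - w * z) ^ Suc m) has_field_derivative
            A * (of_nat (Suc m) * inverse (1 - w * z) ^ m * (w * inverse (1 - w * z) ^ 2))) (at z within U)"
          by (simp add: mult_ac)
        then have "((\<lambda>z. A / (1 - w * z) ^ Suc m) has_field_derivative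
            A * (of_nat (Suc m) * w) / (1 - w * z) ^ Suc (Suc m)) (at z within U)"
          by (simp add: divide_inverse power_inverse power2_eq_square mult_ac)
        then show ?thesis
          unfolding euler_integrand_def D_def Suc w_def A_def .
      qed
    next
      fix z assume "z \<in> U"
      then show "euler_integrand \<alpha> c k z integrable_on cbox 0 1"
        using continuous_on_euler_integrand[of \<alpha> c z k] assms U
        by (auto intro!: integrable_continuous_real)
    next
      show "continuous_on (U \<times> cbox 0 1) (\<lambda>(z, s). D z s)"
        unfolding D_def split_beta
        by (intro continuous_on_powr_nonneg continuous_intros) (use nz assms in auto)
    qed (use U in auto)
    then show ?thesis by simp
  qed
  show ?thesis
    unfolding holomorphic_on_open[OF open_slit_plane]
  proof
    fix z assume "z \<in> slit_plane"
    then obtain e where e: "e > 0" "ball z e \<subseteq> slit_plane"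
      using open_slit_plane open_contains_ball by blast
    have "(\<lambda>z. integral {0..1} (euler_integrand \<alpha> c k z)) holomorphic_on ball z e"
      by (rule loc) (use e in auto)
    then show "\<exists>f'. ((\<lambda>z. integral {0..1} (euler_integrand \<alpha> c k z)) has_field_derivative f') (at z)"
      using e by (auto simp: holomorphic_on_open)
  qed
qed

text \<open>The binomial series with exponent \<open>- k\<close>: rewriting its coefficients as
  rising factorials produces a sign \<open>(-1) ^ n\<close>, which cancels that of
  \<open>(- w) ^ n\<close>.\<close>

lemma sums_inverse_power:
  fixes w :: complex
  assumes "norm w < 1"
  shows "(\<lambda>n. pochhammer (of_nat k) n / fact n * w ^ n) sums (1 / (1 - w) ^ k)"
proof -
  have "(\<lambda>n. ((- of_nat k) gchoose n) * (- w) ^ n) sums (1 + (- w)) powr (- of_nat k)"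
    by (rule gen_binomial_complex) (use assms in auto)
  moreover have "((- of_nat k) gchoose n) * (- w) ^ n = pochhammer (of_nat k) n / fact n * w ^ n" for n
  proof -
    have "(-1) ^ n * (- w) ^ n = w ^ n" by (simp flip: power_mult_distrib)
    then show ?thesis by (simp add: gbinomial_pochhammer mult_ac)
  qed
  moreover have "1 - w \<noteq> 0" using assms by auto
  then have "(1 + (- w)) powr (- of_nat k) = 1 / (1 - w) ^ k"
    by (simp add: powr_minus powr_nat field_simps)
  ultimately show ?thesis by simp
qed

text \<open>Termwise integration: \<open>s powr (c - 1 + n * \<alpha>)\<close> contributes
  \<open>1 / (c + n * \<alpha>)\<close>. Powers of \<open>s\<close> are at most 1, so the terms
  without them serve as bounds in the Weierstrass test.\<close>

lemma sums_euler_integral: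
  assumes "0 < \<alpha>" "1 < c" "norm u < 1"
  shows "(\<lambda>n. pochhammer (of_nat k) n / fact n * u ^ n / of_real (c + real n * \<alpha>))
           sums integral {0..1} (euler_integrand \<alpha> c k u)"
proof -
  define a :: "nat \<Rightarrow> complex" where "a = (\<lambda>n. pochhammer (of_nat k) n / fact n)"
  define f where "f = (\<lambda>n s. complex_of_real (s powr (c - 1)) * (a n * (complex_of_real (s powr \<alpha>) * u) ^ n))"
  have lt: "norm (complex_of_real (s powr \<alpha>) * u) < 1" if "s \<in> {0..1}" for s
  proof -
    have "norm (complex_of_real (s powr \<alpha>) * u) \<le> 1 * norm u"
      unfolding norm_mult using powr_unit_le_1[of s \<alpha>] that assms by (intro mult_right_mono) auto
    then show ?thesis using assms by simp
  qed
  have fs: "(\<lambda>n. f n s) sums euler_integrand \<alpha> c k u s" if "s \<in> {0..1}" for s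
    unfolding f_def euler_integrand_def a_def
    using sums_mult[OF sums_inverse_power[OF lt[OF that], of k], of "complex_of_real (s powr (c - 1))"]
    by simp
  have sm: "summable (\<lambda>n. norm (a n * u ^ n))"
  proof -
    have "summable (\<lambda>n. a n * z ^ n)" if "norm z < 1" for z
      using sums_inverse_power[OF that, of k] unfolding a_def sums_iff by blast
    \<comment> \<open>The midpoint of \<open>norm u\<close> and 1 is still inside the unit disk;
      convergence there gives absolute convergence at \<open>u\<close>.\<close>
    from powser_insidea[OF this[of "of_real ((1 + norm u) / 2)"], of u] assms(3)
    show ?thesis by (simp del: of_real_add of_real_divide add: norm_of_real)
  qed
  have "uniform_limit {0..1} (\<lambda>N s. \<Sum>n<N. f n s) (\<lambda>s. \<Sum>n. f n s) sequentially"
  proof (rule Weierstrass_m_test[OF _ sm])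
    fix n s assume s: "s \<in> {0..1::real}"
    have "norm (f n s) = (s powr (c - 1) * (s powr \<alpha>) ^ n) * norm (a n * u ^ n)"
      by (simp add: f_def norm_mult norm_power power_mult_distrib)
    also have "\<dots> \<le> 1 * norm (a n * u ^ n)"
      using s assms by (intro mult_right_mono mult_le_one powr_unit_le_1 power_le_one) auto
    finally show "norm (f n s) \<le> norm (a n * u ^ n)" by simp
  qed
  then have ul: "uniform_limit {0..1} (\<lambda>N s. \<Sum>n<N. f n s) (euler_integrand \<alpha> c k u) sequentially"
    by (rule uniform_limit_cong'[THEN iffD1, rotated 2]) (use fs in \<open>auto simp: sums_iff\<close>)
  have fi: "(f n has_integral (a n * u ^ n / of_real (c + real n * \<alpha>))) {0..1}" for n
  proof -
    have "0 \<le> real n * \<alpha>" using assms by simp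
    then have "-1 < c - 1 + real n * \<alpha>" using assms by linarith
    from has_integral_powr_from_0[OF this, of 1]
    have "((\<lambda>s. s powr (c - 1 + real n * \<alpha>)) has_integral (1 / (c + real n * \<alpha>))) {0..1}"
      by (simp add: algebra_simps)
    from has_integral_of_real[OF this]
    have "((\<lambda>s. complex_of_real (s powr (c - 1 + real n * \<alpha>)) * (a n * u ^ n)) has_integral
            (complex_of_real (1 / (c + real n * \<alpha>)) * (a n * u ^ n))) {0..1}"
      by (rule has_integral_mult_left)
    then have "((\<lambda>s. complex_of_real (s powr (c - 1 + real n * \<alpha>)) * (a n * u ^ n)) has_integral
            (a n * u ^ n / of_real (c + real n * \<alpha>))) {0..1}" by simp
    then show ?thesis
    proof (rule has_integral_eq[rotated])
      fix s :: real assume "s \<in> {0..1}"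
      \<comment> \<open>At \<open>s = 0\<close> both sides are 0 because
        \<open>0 powr a = 0\<close>; this also covers \<open>n = 0\<close>, where the last factor is
        1.\<close>
      then have "s powr (c - 1 + real n * \<alpha>) = s powr (c - 1) * (s powr \<alpha>) ^ n"
        by (cases "s = 0") (auto simp: powr_add powr_power mult.commute)
      then show "complex_of_real (s powr (c - 1 + real n * \<alpha>)) * (a n * u ^ n) = f n s"
        by (simp add: f_def power_mult_distrib)
    qed
  qed
  have "continuous_on {0..1} (f n)" for n
    unfolding f_def using assms by (intro continuous_on_powr_nonneg continuous_intros) auto
  then have co: "continuous_on {0..1} (\<lambda>s. \<Sum>n<N. f n s)" for N
    by (intro continuous_on_sum)
  obtain I J where I: "\<And>N. ((\<lambda>s. \<Sum>n<N. f n s) has_integral I N) {0..1}"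
    and J: "(euler_integrand \<alpha> c k u has_integral J) {0..1}" and lim: "I \<longlonglongrightarrow> J"
    by (rule uniform_limit_integral[OF ul co]) auto
  have "I = (\<lambda>N. \<Sum>n<N. a n * u ^ n / of_real (c + real n * \<alpha>))"
    by (rule ext, rule has_integral_unique[OF I has_integral_sum]) (use fi in auto)
  with lim have "(\<lambda>n. a n * u ^ n / of_real (c + real n * \<alpha>)) sums J"
    by (simp add: sums_def)
  then show ?thesis using integral_unique[OF J] by (simp add: a_def)
qed

text \<open>The quotient of the rising factorials of \<open>b\<close> and \<open>b + 1\<close>
  telescopes to \<open>b / (b + n)\<close>, which is the factor left by termwise integration.
  Agreement on the unit disk extends to the slit plane by uniqueness of continuation.\<close>

theorem hyp2F1_eq_euler_integral:
  assumes "0 < \<alpha>" "1 < c" "z \<in> slit_plane"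
  shows "hyp2F1 (of_nat k) (of_real (c / \<alpha>)) (of_real (c / \<alpha> + 1)) z =
           of_real c * integral {0..1} (euler_integrand \<alpha> c k z)"
proof (rule hyp2F1_eqI[OF _ _ assms(3)])
  show "(\<lambda>z. of_real c * integral {0..1} (euler_integrand \<alpha> c k z)) holomorphic_on slit_plane"
    by (intro holomorphic_intros holomorphic_euler_integral assms)
next
  fix u :: complex assume u: "norm u < 1"
  define b where "b = c / \<alpha>"
  have b: "b > 0" using assms by (simp add: b_def)
  have ratio: "pochhammer (complex_of_real b) n / pochhammer (complex_of_real (b + 1)) n =
      complex_of_real (c / (c + real n * \<alpha>))" for n
  proof -
    have "pochhammer b n * (b + real n) = b * pochhammer (b + 1) n"
      using pochhammer_rec[of b n] pochhammer_rec'[of b n] by (simp add: mult.commute)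
    moreover have "pochhammer (b + 1) n > 0" using b by (intro pochhammer_pos) auto
    ultimately have "pochhammer b n / pochhammer (b + 1) n = b / (b + real n)"
      using b by (simp add: field_simps)
    also have "\<dots> = c / (c + real n * \<alpha>)"
      using assms by (simp add: b_def field_simps)
    finally show ?thesis
      unfolding pochhammer_of_real of_real_divide[symmetric] by (simp only:)
  qed
  have "(\<lambda>n. of_real c * (pochhammer (of_nat k) n / fact n * u ^ n / of_real (c + real n * \<alpha>)))
          sums (of_real c * integral {0..1} (euler_integrand \<alpha> c k u))"
    by (rule sums_mult[OF sums_euler_integral[OF assms(1,2) u]])
  moreover have "of_real c * (pochhammer (of_nat k) n / fact n * u ^ n / of_real (c + real n * \<alpha>)) =
      fps_nth (fps_hypergeo [of_nat k, of_real b] [of_real (b + 1)] 1) n * u ^ n" for n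
  proof -
    have "fps_nth (fps_hypergeo [of_nat k, of_real b] [of_real (b + 1)] 1) n * u ^ n =
        (pochhammer (complex_of_real b) n / pochhammer (complex_of_real (b + 1)) n) *
        (pochhammer (of_nat k) n / fact n * u ^ n)"
      unfolding gauss_series_nth by simp
    then show ?thesis unfolding ratio by simp
  qed
  ultimately show "of_real c * integral {0..1} (euler_integrand \<alpha> c k u) =
      eval_fps (fps_hypergeo [of_nat k, of_real (c / \<alpha>)] [of_real (c / \<alpha> + 1)] 1) u"
    unfolding eval_fps_def b_def[symmetric] by (simp add: sums_iff)
qed

text \<open>The substitution \<open>r = x * s\<close> moves the integral to \<open>{0..1}\<close>
  and brings out \<open>x powr c\<close>.\<close>

lemma integral_eq_hyp2F1:
  fixes \<alpha> \<beta> c x :: real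
  assumes "0 < \<alpha>" "0 < \<beta>" "1 < c" "0 \<le> x"
  shows "complex_of_real (integral {0..x} (\<lambda>r. r powr (c - 1) / (1 + r powr \<alpha> / \<beta>) ^ k)) =
           of_real (x powr c / c) *
           hyp2F1 (of_nat k) (of_real (c / \<alpha>)) (of_real (c / \<alpha> + 1)) (of_real (- (x powr \<alpha> / \<beta>)))"
proof (cases "x = 0")
  case True
  then show ?thesis by simp
next
  case False
  with assms have x: "x > 0" by simp
  define v where "v = - (x powr \<alpha> / \<beta>)"
  have v: "v \<le> 0" using assms by (simp add: v_def)
  \<comment> \<open>A nonpositive argument avoids the cut however large \<open>x\<close> is, also
    outside the unit disk.\<close>
  have slit: "complex_of_real v \<in> slit_plane" using v by (auto simp: slit_plane_def)
  have den: "1 + r powr \<alpha> / \<beta> > 0" for r using assms by (intro add_pos_nonneg) auto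
  have "continuous_on {0..x} (\<lambda>r. r powr (c - 1) / (1 + r powr \<alpha> / \<beta>) ^ k)"
    using assms den by (intro continuous_on_powr_nonneg continuous_intros) (auto simp: less_imp_neq[symmetric])
  then have "(\<lambda>r. r powr (c - 1) / (1 + r powr \<alpha> / \<beta>) ^ k) integrable_on {0..x}"
    by (rule integrable_continuous_real)
  then have "((\<lambda>r. r powr (c - 1) / (1 + r powr \<alpha> / \<beta>) ^ k) has_integral
      integral {0..x} (\<lambda>r. r powr (c - 1) / (1 + r powr \<alpha> / \<beta>) ^ k)) {0..x}" (is "(?f has_integral ?I) _")
    by (simp add: integrable_integral)
  from has_integral_stretch_real[OF this, of x] x
  have "((\<lambda>s. ?f (x * s)) has_integral (1 / x * ?I)) {0..1}" by simp
  from has_integral_mult_right[OF this, of "x"] x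
  have 1: "((\<lambda>s. x * ?f (x * s)) has_integral ?I) {0..1}" by simp
  have 2: "complex_of_real (x * ?f (x * s)) = of_real (x powr c) * euler_integrand \<alpha> c k (of_real v) s"
    if "s \<in> {0..1}" for s
  proof -
    have "x * x powr (c - 1) = x powr c" using x by (simp add: powr_diff)
    then have "x * ?f (x * s) = x powr c * (s powr (c - 1) / (1 - s powr \<alpha> * v) ^ k)"
      using x that by (simp add: powr_mult v_def mult_ac)
    then show ?thesis by (simp add: euler_integrand_def)
  qed
  have "((\<lambda>s. complex_of_real (x * ?f (x * s))) has_integral complex_of_real ?I) {0..1}"
    by (rule has_integral_of_real[OF 1])
  then have "((\<lambda>s. of_real (x powr c) * euler_integrand \<alpha> c k (of_real v) s) has_integral complex_of_real ?I) {0..1}"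
    by (rule has_integral_eq[rotated]) (use 2 in auto)
  from integral_unique[OF this, symmetric]
  have "complex_of_real ?I = of_real (x powr c) * integral {0..1} (euler_integrand \<alpha> c k (of_real v))"
    unfolding integral_mult_right .
  also have "integral {0..1} (euler_integrand \<alpha> c k (of_real v)) =
     hyp2F1 (of_nat k) (of_real (c / \<alpha>)) (of_real (c / \<alpha> + 1)) (of_real v) / of_real c"
    using hyp2F1_eq_euler_integral[OF assms(1,3) slit, of k] assms by simp
  finally show ?thesis by (simp add: v_def)
qed

section \<open>Closed forms of \<open>Psi\<close> and \<open>G_fun\<close>\<close>

lemma Psi_eq_hyp2F1:
  assumes "0 < \<alpha>" "0 < \<beta>" "0 \<le> x"
  shows "complex_of_real (Psi \<alpha> \<beta> x) =
        complex_of_real (x powr (\<alpha> + 2) / (2 + \<alpha>)) *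
        hyp2F1 1 (complex_of_real (2 / \<alpha> + 1)) (complex_of_real (2 / \<alpha> + 2))
          (complex_of_real (- (x powr \<alpha> / \<beta>)))"
proof -
  \<comment> \<open>This is the case \<open>k = 1\<close>, \<open>c = \<alpha> + 2\<close>.\<close>
  have "(\<alpha> + 2) / \<alpha> = 2 / \<alpha> + 1" using assms by (simp add: field_simps)
  then show ?thesis
    using integral_eq_hyp2F1[of \<alpha> \<beta> "\<alpha> + 2" x 1] assms
    by (simp add: Psi_def divide_inverse add_ac)
qed

lemma G_fun_eq_hyp2F1:
  assumes "0 < \<alpha>" "0 < \<beta>" "0 \<le> x"
  shows "complex_of_real (G_fun \<alpha> \<beta> x) =
        complex_of_real (x powr (2 * \<alpha> + 2) / ((2 + 2 * \<alpha>) * \<beta>\<^sup>2)) *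
        hyp2F1 2 (complex_of_real ((2 + 2 * \<alpha>) / \<alpha>)) (complex_of_real ((2 + 3 * \<alpha>) / \<alpha>))
          (complex_of_real (- (x powr \<alpha> / \<beta>)))"
proof -
  have 1: "(2 + 2 * \<alpha>) / \<alpha> + 1 = (2 + 3 * \<alpha>) / \<alpha>" using assms by (simp add: field_simps)
  \<comment> \<open>Taking \<open>\<beta>\<close> out of the denominator leads to the case
    \<open>k = 2\<close>, \<open>c = 2 + 2 * \<alpha>\<close> and leaves the
    \<open>\<beta>\<^sup>2\<close> of the closed form.\<close>
  have "r powr (2 * \<alpha> + 1) / (\<beta> + r powr \<alpha>)\<^sup>2 =
     (1 / \<beta>\<^sup>2) * (r powr (2 * \<alpha> + 1) / (1 + r powr \<alpha> / \<beta>) ^ 2)" for r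
  proof -
    have "\<beta> + r powr \<alpha> = \<beta> * (1 + r powr \<alpha> / \<beta>)" using assms by (simp add: field_simps)
    then show ?thesis by (simp add: power_mult_distrib)
  qed
  then have "G_fun \<alpha> \<beta> x = (1 / \<beta>\<^sup>2) * integral {0..x} (\<lambda>r. r powr (2 * \<alpha> + 1) / (1 + r powr \<alpha> / \<beta>) ^ 2)"
    unfolding G_fun_def by (simp only: integral_mult_right)
  moreover note integral_eq_hyp2F1[of \<alpha> \<beta> "2 + 2 * \<alpha>" x 2]
  ultimately show ?thesis
    unfolding 1 using assms by (simp add: add.commute mult.commute)
qed


section \<open>Averages of radial functions over a disk\<close>

definition vec_complex :: "real^2 \<Rightarrow> complex" where
  "vec_complex v = Complex (v $ 1) (v $ 2)"

definition complex_vec :: "complex \<Rightarrow> real^2" where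
  "complex_vec z = vector [Re z, Im z]"

lemma complex_vec_inverse [simp]: "vec_complex (complex_vec z) = z"
  by (simp add: vec_complex_def complex_vec_def)

lemma vec_complex_inverse [simp]: "complex_vec (vec_complex v) = v"
  by (simp add: vec_complex_def complex_vec_def vec_eq_iff forall_2)

lemma continuous_on_vec_complex: "continuous_on UNIV vec_complex"
  unfolding vec_complex_def Complex_eq by (intro continuous_intros)

lemma measurable_vec_complex [measurable]: "vec_complex \<in> borel_measurable borel"
  by (rule borel_measurable_continuous_onI[OF continuous_on_vec_complex])

lemma vimage_vec_complex_box: "vec_complex -` box l u = box (complex_vec l) (complex_vec u)"
  by (auto simp: mem_box_cart in_box_complex_iff vec_complex_def complex_vec_def forall_2)

text \<open>Lebesgue measure is determined by its values on boxes, and the coordinate map pulls a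
  box back to a box with the same sides.\<close>

lemma lborel_complex_eq_distr: "distr lborel borel vec_complex = lborel"
proof (rule lborel_eqI[symmetric])
  fix l u :: complex
  assume le: "\<And>b. b \<in> Basis \<Longrightarrow> l \<bullet> b \<le> u \<bullet> b"
  have B: "(Basis :: (real^2) set) = {axis 1 1, axis 2 1}"
    unfolding Basis_vec_def UNIV_2 by auto
  have ne: "axis (1::2) (1::real) \<noteq> axis 2 1" by (simp add: axis_eq_axis)
  have le': "Re l \<le> Re u" "Im l \<le> Im u"
    using le[of 1] le[of \<i>] by (auto simp: Basis_complex_def)
  have "emeasure lborel (box (complex_vec l) (complex_vec u)) = (\<Prod>b\<in>Basis. (complex_vec u - complex_vec l) \<bullet> b)"
    by (rule emeasure_lborel_box) (use le' in \<open>auto simp: B inner_axis complex_vec_def\<close>)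
  also have "(\<Prod>b\<in>Basis. (complex_vec u - complex_vec l) \<bullet> b) = (\<Prod>b\<in>Basis. (u - l) \<bullet> b)"
    using ne by (simp add: B inner_axis complex_vec_def Basis_complex_def)
  finally show "emeasure (distr lborel borel vec_complex) (box l u) = (\<Prod>b\<in>Basis. (u - l) \<bullet> b)"
    by (simp add: emeasure_distr vimage_vec_complex_box)
qed simp

lemma orthogonal_transformation_rotation:
  assumes "norm u = 1"
  shows "orthogonal_transformation (\<lambda>v. complex_vec (u * vec_complex v))"
  unfolding orthogonal_transformation
proof
  show "linear (\<lambda>v. complex_vec (u * vec_complex v))"
    by (rule linearI) (auto simp: complex_vec_def vec_complex_def vec_eq_iff forall_2 algebra_simps)
  have n: "norm (complex_vec z) = norm z" for z
    by (simp add: norm_vec_def L2_set_def UNIV_2 complex_vec_def cmod_def)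
  have "norm (vec_complex v) = norm v" for v
    using n[of "vec_complex v"] by simp
  then show "\<forall>v. norm (complex_vec (u * vec_complex v)) = norm v"
    using assms by (simp add: n norm_mult)
qed

text \<open>\<open>measure_orthogonal_image\<close> concerns orthogonal maps of Cartesian vectors,
  hence the passage through \<open>real^2\<close>.\<close>

lemma lborel_distr_rotation:
  fixes u :: complex
  assumes u: "norm u = 1"
  shows "distr lborel borel (\<lambda>z. u * z) = lborel"
proof (rule lborel_eqI[symmetric])
  fix l r :: complex
  assume le: "\<And>b. b \<in> Basis \<Longrightarrow> l \<bullet> b \<le> r \<bullet> b"
  define B where "B = vec_complex -` box l r"
  have B: "B \<in> lmeasurable" "B \<in> sets borel" unfolding B_def vimage_vec_complex_box by auto
  have uu: "cnj u * u = 1" "u * cnj u = 1"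
    using u complex_norm_square[of u] by (auto simp: mult.commute)
  \<comment> \<open>The inverse rotation: it turns the preimage of the box into an image, the form
    in which invariance is applied.\<close>
  define T where "T = (\<lambda>v. complex_vec (cnj u * vec_complex v))"
  have T: "orthogonal_transformation T"
    unfolding T_def using u by (intro orthogonal_transformation_rotation) simp
  have im: "vec_complex -` ((\<lambda>z. u * z) -` box l r) = T ` B"
  proof (intro equalityI subsetI)
    fix v assume v: "v \<in> vec_complex -` ((\<lambda>z. u * z) -` box l r)"
    have "v = T (complex_vec (u * vec_complex v))"
      by (simp add: T_def uu flip: mult.assoc)
    moreover have "complex_vec (u * vec_complex v) \<in> B" using v by (simp add: B_def)
    ultimately show "v \<in> T ` B" by blast
  next
    fix v assume "v \<in> T ` B"
    then show "v \<in> vec_complex -` ((\<lambda>z. u * z) -` box l r)"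
      by (auto simp: T_def B_def uu simp flip: mult.assoc)
  qed
  have [measurable]: "(\<lambda>z. u * z) \<in> borel_measurable borel" by simp
  have m: "(\<lambda>z. u * z) -` box l r \<in> sets borel"
    using measurable_sets[of "\<lambda>z. u * z" borel borel "box l r"] by simp
  have m': "T ` B \<in> sets borel"
    unfolding im[symmetric] using measurable_sets[OF measurable_vec_complex m] by simp
  have "emeasure (distr lborel borel (\<lambda>z. u * z)) (box l r) = emeasure lborel ((\<lambda>z. u * z) -` box l r)"
    by (simp add: emeasure_distr)
  also have "\<dots> = emeasure (distr lborel borel vec_complex) ((\<lambda>z. u * z) -` box l r)"
    by (simp add: lborel_complex_eq_distr)
  also have "\<dots> = emeasure lborel (T ` B)"
    using m by (simp add: emeasure_distr im)
  \<comment> \<open>Invariance is available for the real-valued \<open>measure lebesgue\<close>, so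
    the chain passes through the completion and through finiteness of both sets.\<close>
  also have "\<dots> = emeasure lebesgue (T ` B)"
    using m' by simp
  also have "\<dots> = ennreal (measure lebesgue (T ` B))"
    using measurable_orthogonal_image[OF T B(1)] by (intro emeasure_eq_measure2) (auto simp: fmeasurable_def)
  also have "\<dots> = ennreal (measure lebesgue B)"
    by (simp add: measure_orthogonal_image[OF T B(1)])
  also have "\<dots> = emeasure lebesgue B"
    using B by (intro emeasure_eq_measure2[symmetric]) (auto simp: fmeasurable_def)
  also have "\<dots> = emeasure lborel B"
    using B by simp
  also have "\<dots> = emeasure (distr lborel borel vec_complex) (box l r)"
    by (simp add: emeasure_distr B_def)
  also have "\<dots> = (\<Prod>b\<in>Basis. (r - l) \<bullet> b)"
    using le by (simp add: lborel_complex_eq_distr)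
  finally show "emeasure (distr lborel borel (\<lambda>z. u * z)) (box l r) = (\<Prod>b\<in>Basis. (r - l) \<bullet> b)" .
qed simp

lemma nn_integral_rotation:
  fixes u :: complex
  assumes "norm u = 1" and [measurable]: "f \<in> borel_measurable borel"
  shows "(\<integral>\<^sup>+z. f (u * z) \<partial>lborel) = (\<integral>\<^sup>+z. f z \<partial>lborel)"
  using nn_integral_distr[of "\<lambda>z. u * z" lborel borel f] by (simp add: lborel_distr_rotation[OF assms(1)])

text \<open>The density \<open>2 * pi * s\<close> is the derivative of the area of a disk. Comparing
  half-lines \<open>{..a}\<close> suffices: they are stable under intersection and generate the
  Borel sets.\<close>

lemma distr_norm_complex:
  "distr lborel borel (norm :: complex \<Rightarrow> real) = density lborel (\<lambda>s. ennreal (2 * pi * s))"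
proof (rule measure_eqI_generator_eq[where E = "range atMost" and \<Omega> = UNIV and A = "\<lambda>n. {..real n}"])
  have disk: "emeasure lborel {z::complex. norm z \<le> a} = ennreal (if 0 \<le> a then pi * a\<^sup>2 else 0)" for a
  proof (cases "0 \<le> a")
    case True
    have "{z::complex. norm z \<le> a} = cball 0 a" by (auto simp: dist_norm)
    with True show ?thesis by (simp add: emeasure_cball unit_ball_vol_2)
  next
    case False
    then have "{z::complex. norm z \<le> a} = {}" using norm_ge_zero order_trans by blast
    with False show ?thesis by simp
  qed
  have dens: "emeasure (density lborel (\<lambda>s. ennreal (2 * pi * s))) {..a} =
      ennreal (if 0 \<le> a then pi * a\<^sup>2 else 0)" for a :: real
  proof -
    have "emeasure (density lborel (\<lambda>s. ennreal (2 * pi * s))) {..a} =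
        (\<integral>\<^sup>+s. ennreal (2 * pi * s) * indicator {..a} s \<partial>lborel)"
      by (simp add: emeasure_density)
    \<comment> \<open>\<open>ennreal\<close> sends the negative values of the density at
      \<open>s < 0\<close> to 0.\<close>
    also have "\<dots> = (\<integral>\<^sup>+s. ennreal (2 * pi * s) * indicator {0..a} s \<partial>lborel)"
      by (intro nn_integral_cong) (auto simp: indicator_def ennreal_neg mult_nonneg_nonpos)
    also have "\<dots> = ennreal (if 0 \<le> a then pi * a\<^sup>2 else 0)"
    proof (cases "0 \<le> a")
      case True
      have "(\<integral>\<^sup>+s. ennreal (2 * pi * s) * indicator {0..a} s \<partial>lborel) = ennreal (pi * a\<^sup>2 - pi * 0\<^sup>2)"
        by (rule nn_integral_FTC_Icc) (use True in \<open>auto intro!: derivative_eq_intros\<close>)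
      with True show ?thesis by simp
    qed simp
    finally show ?thesis .
  qed
  show "Int_stable (range atMost :: real set set)"
    by (auto simp: Int_stable_def)
  show "emeasure (distr lborel borel (norm :: complex \<Rightarrow> real)) X = emeasure (density lborel (\<lambda>s. ennreal (2 * pi * s))) X"
    if "X \<in> range atMost" for X
    using that by (auto simp: emeasure_distr dens disk vimage_def)
  show "emeasure (distr lborel borel (norm :: complex \<Rightarrow> real)) {..real i} \<noteq> \<infinity>" for i
    by (simp add: emeasure_distr disk vimage_def)
  show "(\<Union>i. {..real i}) = UNIV" using real_arch_simple by auto
qed (auto simp: borel_eq_atMost)

lemma nn_integral_radial:
  assumes [measurable]: "f \<in> borel_measurable borel"
  shows "(\<integral>\<^sup>+z. f (norm (z::complex)) \<partial>lborel) = (\<integral>\<^sup>+s. ennreal (2 * pi * s) * f s \<partial>lborel)"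
proof -
  have "(\<integral>\<^sup>+z. f (norm (z::complex)) \<partial>lborel) = (\<integral>\<^sup>+s. f s \<partial>(distr lborel borel (norm :: complex \<Rightarrow> real)))"
    by (simp add: nn_integral_distr)
  also have "\<dots> = (\<integral>\<^sup>+s. ennreal (2 * pi * s) * f s \<partial>lborel)"
    unfolding distr_norm_complex by (simp add: nn_integral_density)
  finally show ?thesis .
qed

section \<open>Integration over a full turn and the angle of an arc\<close>

lemma nn_integral_lborel_shift:
  fixes f :: "real \<Rightarrow> ennreal"
  assumes "f \<in> borel_measurable borel"
  shows "(\<integral>\<^sup>+x. f (x + t) \<partial>lborel) = (\<integral>\<^sup>+x. f x \<partial>lborel)"
  using nn_integral_real_affine[OF assms, of 1 t] by (simp add: add.commute)

text \<open>The shifted window overhangs \<open>{-pi..<pi}\<close> by a piece of length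
  \<open>d\<close>; moving that piece back by one period fills exactly the part left uncovered. The
  bound on \<open>d\<close> makes a single period enough.\<close>

lemma nn_integral_periodic_shift:
  fixes f :: "real \<Rightarrow> ennreal"
  assumes [measurable]: "f \<in> borel_measurable borel" and per: "\<And>x. f (x + 2 * pi) = f x"
    and d: "0 \<le> d" "d \<le> 2 * pi"
  shows "(\<integral>\<^sup>+x. f (x + d) * indicator {-pi..<pi} x \<partial>lborel) = (\<integral>\<^sup>+x. f x * indicator {-pi..<pi} x \<partial>lborel)"
proof -
  have "(\<integral>\<^sup>+x. f (x + d) * indicator {-pi..<pi} x \<partial>lborel)
      = (\<integral>\<^sup>+x. f (x + d) * indicator {-pi + d..<pi + d} (x + d) \<partial>lborel)"
    by (intro nn_integral_cong) (auto simp: indicator_def)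
  also have "\<dots> = (\<integral>\<^sup>+x. f x * indicator {-pi + d..<pi + d} x \<partial>lborel)"
    by (rule nn_integral_lborel_shift) measurable
  also have "\<dots> = (\<integral>\<^sup>+x. f x * indicator {-pi + d..<pi} x + f x * indicator {pi..<pi + d} x \<partial>lborel)"
    using d by (intro nn_integral_cong) (auto simp: indicator_def)
  also have "\<dots> = (\<integral>\<^sup>+x. f x * indicator {-pi + d..<pi} x \<partial>lborel) + (\<integral>\<^sup>+x. f x * indicator {pi..<pi + d} x \<partial>lborel)"
    by (rule nn_integral_add) auto
  also have "(\<integral>\<^sup>+x. f x * indicator {pi..<pi + d} x \<partial>lborel) =
      (\<integral>\<^sup>+x. f (x + 2 * pi) * indicator {pi..<pi + d} (x + 2 * pi) \<partial>lborel)"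
    by (rule nn_integral_lborel_shift[symmetric]) measurable
  also have "\<dots> = (\<integral>\<^sup>+x. f x * indicator {-pi..<-pi + d} x \<partial>lborel)"
    by (intro nn_integral_cong) (auto simp: indicator_def per)
  also have "(\<integral>\<^sup>+x. f x * indicator {-pi + d..<pi} x \<partial>lborel) + \<dots> =
      (\<integral>\<^sup>+x. f x * indicator {-pi + d..<pi} x + f x * indicator {-pi..<-pi + d} x \<partial>lborel)"
    by (rule nn_integral_add[symmetric]) auto
  also have "\<dots> = (\<integral>\<^sup>+x. f x * indicator {-pi..<pi} x \<partial>lborel)"
    using d by (intro nn_integral_cong) (auto simp: indicator_def)
  finally show ?thesis .
qed

text \<open>The length of the arc of the circle of radius \<open>s\<close> about a receiver at distance \<open>r0\<close>
  from the origin that lies in the disk of radius \<open>R\<close>, divided by \<open>s\<close>.\<close>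

definition arc_angle :: "real \<Rightarrow> real \<Rightarrow> real \<Rightarrow> ennreal" where
  "arc_angle r0 R s =
     (\<integral>\<^sup>+\<phi>. indicator {w. norm w \<le> R} (complex_of_real s + of_real r0 * cis \<phi>) * indicator {-pi..<pi} \<phi> \<partial>lborel)"

lemma measurable_cis [measurable]: "cis \<in> borel_measurable borel"
  by (intro borel_measurable_continuous_onI continuous_intros)

lemma measurable_arc_angle [measurable]: "arc_angle r0 R \<in> borel_measurable borel"
  unfolding arc_angle_def by measurable

lemma arc_angle_le: "arc_angle r0 R s \<le> ennreal (2 * pi)"
proof -
  have "arc_angle r0 R s \<le> (\<integral>\<^sup>+\<phi>. indicator {-pi..<pi} \<phi> \<partial>lborel)"
    unfolding arc_angle_def by (intro nn_integral_mono) (auto simp: indicator_def)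
  then show ?thesis by simp
qed

lemma arc_angle_inside:
  assumes "0 \<le> s" "0 \<le> r0" "s + r0 \<le> R"
  shows "arc_angle r0 R s = ennreal (2 * pi)"
proof -
  have "norm (complex_of_real s + of_real r0 * cis \<phi>) \<le> R" for \<phi>
    using norm_triangle_ineq[of "complex_of_real s" "of_real r0 * cis \<phi>"] assms by (simp add: norm_mult)
  then have "arc_angle r0 R s = (\<integral>\<^sup>+\<phi>. indicator {-pi..<pi} \<phi> \<partial>lborel)"
    unfolding arc_angle_def by simp
  then show ?thesis by simp
qed

lemma arc_angle_outside:
  assumes "0 \<le> r0" "R + r0 < s"
  shows "arc_angle r0 R s = 0"
proof -
  have "\<not> norm (complex_of_real s + of_real r0 * cis \<phi>) \<le> R" for \<phi>
    using norm_diff_ineq[of "complex_of_real s" "of_real r0 * cis \<phi>"] assms by (simp add: norm_mult)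
  then show ?thesis
    unfolding arc_angle_def by simp
qed

text \<open>By the law of cosines the point lies in the disk iff
  \<open>cos \<phi> \<le> - c\<close>. This is a condition on the absolute value of
  \<open>\<phi>\<close> alone, so it cuts out two mirror arcs of angle \<open>arccos c\<close>
  each.\<close>

lemma arc_angle_cross:
  assumes "0 < s" "0 < r0" "r0 \<le> R" "R - r0 \<le> s" "s \<le> R + r0"
  shows "arc_angle r0 R s = ennreal (2 * arccos ((s\<^sup>2 + r0\<^sup>2 - R\<^sup>2) / (2 * s * r0)))"
proof -
  define c where "c = (s\<^sup>2 + r0\<^sup>2 - R\<^sup>2) / (2 * s * r0)"
  \<comment> \<open>The triangle inequalities for the sides \<open>s\<close>, \<open>r0\<close>,
    \<open>R\<close>; they are what puts \<open>c\<close> into the domain of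
    \<open>arccos\<close>.\<close>
  have "(s - r0)\<^sup>2 \<le> R\<^sup>2" "R\<^sup>2 \<le> (s + r0)\<^sup>2"
    using assms by (auto simp: abs_le_square_iff[symmetric] intro!: power_mono)
  then have c: "-1 \<le> c" "c \<le> 1"
    using assms unfolding c_def by (auto simp: field_simps power2_eq_square)
  \<comment> \<open>At \<open>\<phi> = 0\<close> the point is farthest from the origin;
    \<open>\<gamma>\<close> is the turn after which it enters the disk.\<close>
  define \<gamma> where "\<gamma> = pi - arccos c"
  have g: "0 \<le> \<gamma>" "\<gamma> \<le> pi" "cos \<gamma> = - c"
    using arccos_bounded[OF c] c by (auto simp: \<gamma>_def)
  have iff: "norm (complex_of_real s + of_real r0 * cis \<phi>) \<le> R \<longleftrightarrow> \<gamma> \<le> \<bar>\<phi>\<bar>"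
    if "\<phi> \<in> {-pi..<pi}" for \<phi>
  proof -
    have sq: "(norm (complex_of_real s + of_real r0 * cis \<phi>))\<^sup>2 = s\<^sup>2 + r0\<^sup>2 + 2 * s * r0 * cos \<phi>"
    proof -
      have "(norm (complex_of_real s + of_real r0 * cis \<phi>))\<^sup>2 = (s + r0 * cos \<phi>)\<^sup>2 + (r0 * sin \<phi>)\<^sup>2"
        by (simp add: cmod_power2)
      also have "\<dots> = s\<^sup>2 + r0\<^sup>2 * ((sin \<phi>)\<^sup>2 + (cos \<phi>)\<^sup>2) + 2 * s * r0 * cos \<phi>"
        unfolding distrib_left by (simp add: power2_eq_square algebra_simps)
      finally show ?thesis by (simp only: sin_cos_squared_add mult_1_right)
    qed
    have "norm (complex_of_real s + of_real r0 * cis \<phi>) \<le> R \<longleftrightarrow> (norm (complex_of_real s + of_real r0 * cis \<phi>))\<^sup>2 \<le> R\<^sup>2"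
      using assms abs_le_square_iff[of "norm (complex_of_real s + of_real r0 * cis \<phi>)" R] by simp
    also have "\<dots> \<longleftrightarrow> cos \<phi> \<le> - c"
      unfolding sq c_def using assms by (simp add: field_simps)
    also have "\<dots> \<longleftrightarrow> cos \<bar>\<phi>\<bar> \<le> cos \<gamma>"
      by (simp add: g)
    also have "\<dots> \<longleftrightarrow> \<gamma> \<le> \<bar>\<phi>\<bar>"
      using g that by (intro cos_mono_le_eq) auto
    finally show ?thesis .
  qed
  have "arc_angle r0 R s = (\<integral>\<^sup>+\<phi>. indicator {-pi..<-\<gamma>} \<phi> + indicator {\<gamma>..<pi} \<phi> \<partial>lborel)"
    unfolding arc_angle_def
  proof (rule nn_integral_cong_AE)
    \<comment> \<open>The half-open interval \<open>{-pi..<-\<gamma>}\<close> misses the endpoint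
      \<open>-\<gamma>\<close>, which does satisfy the condition.\<close>
    have "AE \<phi> in lborel. \<phi> \<noteq> -\<gamma>" by (rule AE_lborel_singleton)
    then show "AE \<phi> in lborel. indicator {w. norm w \<le> R} (complex_of_real s + of_real r0 * cis \<phi>) * indicator {-pi..<pi} \<phi> =
        (indicator {-pi..<-\<gamma>} \<phi> + indicator {\<gamma>..<pi} \<phi> :: ennreal)"
    proof eventually_elim
      case (elim \<phi>)
      then show ?case
        using iff[of \<phi>] g by (cases "\<phi> \<in> {-pi..<pi}") (auto simp: indicator_def)
    qed
  qed
  also have "\<dots> = ennreal (pi - \<gamma>) + ennreal (pi - \<gamma>)"
    using g by (subst nn_integral_add) auto
  also have "\<dots> = ennreal (2 * (pi - \<gamma>))"
    using g by (simp flip: ennreal_plus)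
  finally show ?thesis by (simp add: \<gamma>_def c_def)
qed

text \<open>Factoring out the direction of \<open>z\<close> preserves norms and makes the centre a
  positive real. What remains of the direction of \<open>Y\<close> is a phase \<open>d\<close>,
  removed by a shift within the period.\<close>

lemma nn_integral_rotating_centre:
  fixes z Y :: complex
  assumes z: "z \<noteq> 0" and Y: "norm Y = r0" and "0 < r0"
  shows "(\<integral>\<^sup>+\<phi>. indicator {w. norm w \<le> R} (z + Y * cis \<phi>) * indicator {-pi..<pi} \<phi> \<partial>lborel) = arc_angle r0 R (norm z)"
proof -
  define d where "d = Arg2pi (Y / z)"
  have d: "0 \<le> d" "d \<le> 2 * pi"
    unfolding d_def using Arg2pi_ge_0 Arg2pi_lt_2pi less_imp_le by blast+
  have Yz: "Y = z * (of_real (r0 / norm z) * cis d)"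
    using Arg2pi_eq[of "Y / z"] z Y by (simp add: d_def cis_conv_exp norm_divide field_simps)
  have "norm (z + Y * cis \<phi>) = norm (complex_of_real (norm z) + of_real r0 * cis (\<phi> + d))" for \<phi>
  proof -
    have "z + Y * cis \<phi> = z / of_real (norm z) * (of_real (norm z) + of_real r0 * cis (\<phi> + d))"
      using z by (subst Yz) (simp add: field_simps flip: cis_mult)
    then show ?thesis using z by (simp add: norm_mult norm_divide)
  qed
  then have "(\<integral>\<^sup>+\<phi>. indicator {w. norm w \<le> R} (z + Y * cis \<phi>) * indicator {-pi..<pi} \<phi> \<partial>lborel) =
      (\<integral>\<^sup>+\<phi>. indicator {w. norm w \<le> R} (complex_of_real (norm z) + of_real r0 * cis (\<phi> + d)) * indicator {-pi..<pi} \<phi> \<partial>lborel)"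
    by (intro nn_integral_cong) (simp add: indicator_def)
  also have "\<dots> = arc_angle r0 R (norm z)"
    unfolding arc_angle_def
    by (rule nn_integral_periodic_shift[where f = "\<lambda>x. indicator {w. norm w \<le> R} (complex_of_real (norm z) + of_real r0 * cis x)"])
       (use d in \<open>auto simp flip: cis_mult\<close>)
  finally show ?thesis .
qed

text \<open>Averaging over the angle costs a factor \<open>2 * pi\<close> and the radial law returns
  the same factor, so the bare weight \<open>s\<close> remains.\<close>

lemma nn_integral_disk_radial:
  fixes Y :: complex and f :: "real \<Rightarrow> ennreal"
  assumes Y: "norm Y = r0" "0 < r0" and [measurable]: "f \<in> borel_measurable borel"
  shows "(\<integral>\<^sup>+w. f (norm (w - Y)) * indicator (cball 0 R) w \<partial>lborel) =
         (\<integral>\<^sup>+s. ennreal s * f s * arc_angle r0 R s \<partial>lborel)"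
proof -
  define D where "D = {w::complex. norm w \<le> R}"
  have [measurable]: "D \<in> sets borel" unfolding D_def by measurable
  define I where "I = (\<integral>\<^sup>+w. f (norm (w - Y)) * indicator (cball 0 R) w \<partial>lborel)"
  have I1: "I = (\<integral>\<^sup>+z. f (norm z) * indicator D (z + Y) \<partial>lborel)"
  proof -
    have "I = (\<integral>\<^sup>+w. f (norm (w - Y)) * indicator D w \<partial>(distr lborel borel ((+) Y)))"
      unfolding lborel_distr_plus I_def D_def by (intro nn_integral_cong) (auto simp: indicator_def)
    also have "\<dots> = (\<integral>\<^sup>+z. f (norm z) * indicator D (z + Y) \<partial>lborel)"
      by (subst nn_integral_distr) (auto simp: add.commute)
    finally show ?thesis .
  qed
  \<comment> \<open>Turning the plane changes neither \<open>norm z\<close> nor membership in the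
    disk about the origin; only the receiver turns.\<close>
  have I2: "I = (\<integral>\<^sup>+z. f (norm z) * indicator D (z + Y * cis \<phi>) \<partial>lborel)" for \<phi>
  proof -
    have "I = (\<integral>\<^sup>+z. f (norm (cis (-\<phi>) * z)) * indicator D (cis (-\<phi>) * z + Y) \<partial>lborel)"
      unfolding I1 by (rule nn_integral_rotation[symmetric]) auto
    also have "\<dots> = (\<integral>\<^sup>+z. f (norm z) * indicator D (z + Y * cis \<phi>) \<partial>lborel)"
    proof (intro nn_integral_cong)
      fix z
      have "cis (-\<phi>) * z + Y = cis (-\<phi>) * (z + Y * cis \<phi>)"
        by (simp add: algebra_simps cis_mult)
      then have "norm (cis (-\<phi>) * z + Y) = norm (z + Y * cis \<phi>)"
        by (simp add: norm_mult)
      then show "f (norm (cis (-\<phi>) * z)) * indicator D (cis (-\<phi>) * z + Y) = f (norm z) * indicator D (z + Y * cis \<phi>)"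
        by (simp add: norm_mult D_def indicator_def)
    qed
    finally show ?thesis .
  qed
  \<comment> \<open>\<open>I\<close> has the same value for every \<open>\<phi>\<close>, so it may
    be averaged. After exchanging the integrals, \<open>f (norm z)\<close> is constant in
    \<open>\<phi>\<close> and the inner integral is the arc angle.\<close>
  have "ennreal (2 * pi) * I = (\<integral>\<^sup>+\<phi>. I * indicator {-pi..<pi} \<phi> \<partial>lborel)"
    by (simp add: nn_integral_cmult mult.commute)
  also have "\<dots> = (\<integral>\<^sup>+\<phi>. (\<integral>\<^sup>+z. f (norm z) * indicator D (z + Y * cis \<phi>) * indicator {-pi..<pi} \<phi> \<partial>lborel) \<partial>lborel)"
    by (intro nn_integral_cong) (subst I2, simp add: nn_integral_multc)
  also have "\<dots> = (\<integral>\<^sup>+z. (\<integral>\<^sup>+\<phi>. f (norm z) * indicator D (z + Y * cis \<phi>) * indicator {-pi..<pi} \<phi> \<partial>lborel) \<partial>lborel)"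
    by (rule lborel_pair.Fubini') measurable
  also have "\<dots> = (\<integral>\<^sup>+z. f (norm (z::complex)) * arc_angle r0 R (norm z) \<partial>lborel)"
  proof (rule nn_integral_cong_AE)
    \<comment> \<open>At the origin there is no direction to factor out.\<close>
    have "AE z in lborel. z \<noteq> (0::complex)" by (rule AE_lborel_singleton)
    then show "AE z in lborel. (\<integral>\<^sup>+\<phi>. f (norm z) * indicator D (z + Y * cis \<phi>) * indicator {-pi..<pi} \<phi> \<partial>lborel) =
        f (norm z) * arc_angle r0 R (norm z)"
    proof eventually_elim
      case (elim z)
      then show ?case
        unfolding D_def using nn_integral_rotating_centre[OF elim Y, of R]
        by (simp add: mult.assoc nn_integral_cmult)
    qed
  qed
  also have "\<dots> = (\<integral>\<^sup>+s. ennreal (2 * pi * s) * (f s * arc_angle r0 R s) \<partial>lborel)"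
    by (rule nn_integral_radial) measurable
  also have "\<dots> = ennreal (2 * pi) * (\<integral>\<^sup>+s. ennreal s * f s * arc_angle r0 R s \<partial>lborel)"
    by (subst nn_integral_cmult[symmetric]) (auto intro!: nn_integral_cong simp: ennreal_mult' mult.assoc)
  finally show ?thesis
    unfolding I_def by (simp add: ennreal_mult_cancel_left)
qed

text \<open>The scaling \<open>s = r0 * r\<close> turns the weight \<open>s ds\<close> into
  \<open>r0\<^sup>2 * r dr\<close>. The common factor 2 comes from the angles \<open>2 * pi\<close>
  and \<open>2 * arccos (c r)\<close>.\<close>

lemma integral_uniform_disk_radial:
  fixes Y :: complex and h :: "real \<Rightarrow> real"
  assumes Y: "norm Y = r0" "0 < r0" "r0 \<le> R" and [measurable]: "h \<in> borel_measurable borel"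
    and h: "\<And>r. 0 \<le> h r" "\<And>r. h r \<le> 1"
  shows "(\<integral>w. h (norm (w - Y) / r0) \<partial>uniform_measure lborel (cball 0 R)) =
     2 * r0\<^sup>2 / (pi * R\<^sup>2) * (pi * integral {0..(R - r0) / r0} (\<lambda>r. r * h r) +
        integral {(R - r0) / r0..(R + r0) / r0}
          (\<lambda>r. r * h r * arccos ((r0\<^sup>2 * r\<^sup>2 + r0\<^sup>2 - R\<^sup>2) / (2 * r0\<^sup>2 * r))))"
proof -
  define x1 where "x1 = (R - r0) / r0"
  define x2 where "x2 = (R + r0) / r0"
  define c where "c = (\<lambda>r. (r0\<^sup>2 * r\<^sup>2 + r0\<^sup>2 - R\<^sup>2) / (2 * r0\<^sup>2 * r))"
  have x: "0 \<le> x1" "x1 \<le> x2" using Y by (auto simp: x1_def x2_def divide_right_mono)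
  \<comment> \<open>The arc angle is at most \<open>2 * pi\<close>, so passing to a real-valued copy
    loses nothing.\<close>
  define a where "a = (\<lambda>r. enn2real (arc_angle r0 R (r0 * r)))"
  have [measurable]: "a \<in> borel_measurable borel" unfolding a_def by measurable
  have ea: "ennreal (a r) = arc_angle r0 R (r0 * r)" for r
    unfolding a_def using arc_angle_le[of r0 R "r0 * r"]
    by (intro ennreal_enn2real) (auto simp: less_top[symmetric] top_unique)
  have a0: "0 \<le> a r" "a r \<le> 2 * pi" for r
    unfolding a_def using arc_angle_le[of r0 R "r0 * r"] by (auto intro: enn2real_leI)
  have a1: "a r = 2 * pi" if "0 \<le> r" "r \<le> x1" for r
    using that Y arc_angle_inside[of "r0 * r" r0 R] unfolding a_def x1_def by (simp add: field_simps)
  have a2: "r * h r * a r = 2 * (r * h r * arccos (c r))" if "x1 \<le> r" "r \<le> x2" for r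
  \<comment> \<open>Radius 0 is in this range only if \<open>R = r0\<close>. The crossing formula
    needs a positive radius; at 0 the factor \<open>r\<close> makes both sides vanish.\<close>
  proof (cases "r = 0")
    case False
    have r: "0 < r" using False x that by simp
    have "((r0 * r)\<^sup>2 + r0\<^sup>2 - R\<^sup>2) / (2 * (r0 * r) * r0) = c r"
      by (simp add: c_def power2_eq_square mult_ac)
    with arc_angle_cross[of "r0 * r" r0 R] that r Y
    have "ennreal (a r) = ennreal (2 * arccos (c r))"
      unfolding ea x1_def x2_def by (simp add: field_simps)
    moreover have "0 \<le> arccos (c r)"
    proof (rule arccos_lbound)
      have "0 \<le> r0 * r" "R - r0 \<le> r0 * r" "r0 * r \<le> R + r0"
        using that r Y by (auto simp: x1_def x2_def field_simps)
      then have "(r0 * r - r0)\<^sup>2 \<le> R\<^sup>2" "R\<^sup>2 \<le> (r0 * r + r0)\<^sup>2"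
        using Y by (auto simp: abs_le_square_iff[symmetric] intro!: power_mono)
      then show "-1 \<le> c r" "c r \<le> 1"
        using r Y unfolding c_def by (auto simp: field_simps power2_eq_square)
    qed
    ultimately show ?thesis using a0 by simp
  qed simp
  define q where "q = (\<lambda>r. r * h r * a r)"
  have [measurable]: "q \<in> borel_measurable borel" unfolding q_def by measurable
  have q0: "0 \<le> q r" if "0 \<le> r" for r using that h a0 by (simp add: q_def)
  have qb: "norm (q r) \<le> x2 * 1 * (2 * pi)" if "r \<in> {0..x2}" for r
    using that h[of r] a0[of r] unfolding q_def real_norm_def abs_mult
    by (intro mult_mono) auto
  \<comment> \<open>\<open>h\<close> is merely measurable, so integrability is drawn from a bound on
    a bounded interval; the Lebesgue and gauge integrals then agree.\<close>
  have qi: "set_integrable lborel {0..x2} q"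
    unfolding set_integrable_def
    by (rule integrableI_bounded_set_indicator[where B = "x2 * 1 * (2 * pi)"])
       (use qb x in \<open>auto simp: emeasure_lborel_Icc_eq\<close>)
  have qint: "q integrable_on {0..x2}" "(LINT r:{0..x2}|lborel. q r) = integral {0..x2} q"
    using set_borel_integral_eq_integral[OF qi] by auto
  have split: "integral {0..x2} q = 2 * (pi * integral {0..x1} (\<lambda>r. r * h r) + integral {x1..x2} (\<lambda>r. r * h r * arccos (c r)))"
  proof -
    have "integral {0..x2} q = integral {0..x1} q + integral {x1..x2} q"
      using Henstock_Kurzweil_Integration.integral_combine[OF x qint(1)] by simp
    also have "integral {0..x1} q = integral {0..x1} (\<lambda>r. 2 * pi * (r * h r))"
      by (rule integral_cong) (auto simp: q_def a1)
    also have "integral {x1..x2} q = integral {x1..x2} (\<lambda>r. 2 * (r * h r * arccos (c r)))"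
      by (rule integral_cong) (auto simp: q_def a2)
    finally show ?thesis unfolding integral_mult_right by (simp add: algebra_simps)
  qed
  have "(\<integral>\<^sup>+w. ennreal (h (norm (w - Y) / r0)) * indicator (cball 0 R) w \<partial>lborel) =
     (\<integral>\<^sup>+s. ennreal s * ennreal (h (s / r0)) * arc_angle r0 R s \<partial>lborel)"
    by (rule nn_integral_disk_radial[OF Y(1,2), of "\<lambda>s. ennreal (h (s / r0))"]) measurable
  also have "\<dots> = ennreal r0 * (\<integral>\<^sup>+r. ennreal (r0 * r) * ennreal (h r) * arc_angle r0 R (r0 * r) \<partial>lborel)"
    using Y by (subst nn_integral_real_affine[where c = r0 and t = 0]) auto
  also have "\<dots> = (\<integral>\<^sup>+r. ennreal (r0\<^sup>2) * (ennreal (q r) * indicator {0..x2} r) \<partial>lborel)"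
  proof (subst nn_integral_cmult[symmetric], measurable, rule nn_integral_cong)
    fix r :: real
    \<comment> \<open>Negative radii drop out through \<open>ennreal\<close>, radii beyond
      \<open>x2\<close> because the circle misses the disk.\<close>
    consider "r < 0" | "x2 < r" | "0 \<le> r" "r \<le> x2" by linarith
    then show "ennreal r0 * (ennreal (r0 * r) * ennreal (h r) * arc_angle r0 R (r0 * r)) =
        ennreal (r0\<^sup>2) * (ennreal (q r) * indicator {0..x2} r)"
    proof cases
      case 1
      then have "r0 * r \<le> 0" using Y by (simp add: mult_nonneg_nonpos)
      with 1 show ?thesis by (simp add: ennreal_neg)
    next
      case 2
      then have "arc_angle r0 R (r0 * r) = 0"
        using Y by (intro arc_angle_outside) (auto simp: x2_def field_simps)
      with 2 show ?thesis by simp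
    next
      case 3
      then show ?thesis
        unfolding ea[symmetric] q_def using Y h a0
        by (simp add: power2_eq_square mult_ac flip: ennreal_mult')
    qed
  qed
  also have "\<dots> = ennreal (r0\<^sup>2) * (\<integral>\<^sup>+r. ennreal (indicator {0..x2} r *\<^sub>R q r) \<partial>lborel)"
    by (subst nn_integral_cmult) (auto intro!: arg_cong2[where f = "(*)"] nn_integral_cong simp: indicator_def)
  also have "(\<integral>\<^sup>+r. ennreal (indicator {0..x2} r *\<^sub>R q r) \<partial>lborel) = ennreal (integral {0..x2} q)"
    unfolding qint(2)[symmetric] set_lebesgue_integral_def
    using qi q0 by (intro nn_integral_eq_integral) (auto simp: set_integrable_def indicator_def)
  finally have nn: "(\<integral>\<^sup>+w. ennreal (h (norm (w - Y) / r0)) * indicator (cball 0 R) w \<partial>lborel) =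
      ennreal (r0\<^sup>2 * integral {0..x2} q)"
    by (simp add: ennreal_mult')
  have "(\<integral>w. h (norm (w - Y) / r0) \<partial>uniform_measure lborel (cball 0 R)) =
      enn2real (\<integral>\<^sup>+w. ennreal (h (norm (w - Y) / r0)) \<partial>uniform_measure lborel (cball 0 R))"
    by (rule integral_eq_nn_integral) (auto simp: h)
  also have "(\<integral>\<^sup>+w. ennreal (h (norm (w - Y) / r0)) \<partial>uniform_measure lborel (cball 0 R)) =
      ennreal (r0\<^sup>2 * integral {0..x2} q) / ennreal (pi * R\<^sup>2)"
    using Y nn by (subst nn_integral_uniform_measure) (auto simp: emeasure_cball unit_ball_vol_2)
  also have "\<dots> = ennreal (r0\<^sup>2 * integral {0..x2} q / (pi * R\<^sup>2))"
    using Y q0 by (intro divide_ennreal mult_nonneg_nonneg integral_nonneg qint) auto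
  also have "enn2real \<dots> = r0\<^sup>2 * integral {0..x2} q / (pi * R\<^sup>2)"
    using Y q0 by (intro enn2real_ennreal divide_nonneg_nonneg mult_nonneg_nonneg integral_nonneg qint) auto
  finally show ?thesis
    unfolding split unfolding x1_def x2_def c_def by simp
qed


section \<open>The outage probability under Rayleigh fading\<close>

text \<open>The joint law is a product, so Fubini applies: \<open>Y\<close> is frozen at
  \<open>\<omega>\<close> while an independent copy \<open>\<omega>'\<close> integrates
  \<open>Z\<close> out. Conditioning takes this form in the proofs below.\<close>

lemma (in prob_space) indep_var_nn_integral:
  assumes "indep_var S Y T Z" and [measurable]: "f \<in> borel_measurable (S \<Otimes>\<^sub>M T)"
  shows "(\<integral>\<^sup>+\<omega>. f (Y \<omega>, Z \<omega>) \<partial>M) = (\<integral>\<^sup>+\<omega>. (\<integral>\<^sup>+\<omega>'. f (Y \<omega>, Z \<omega>') \<partial>M) \<partial>M)"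
proof -
  have [measurable]: "random_variable S Y" "random_variable T Z"
    and eq: "distr M S Y \<Otimes>\<^sub>M distr M T Z = distr M (S \<Otimes>\<^sub>M T) (\<lambda>x. (Y x, Z x))"
    using assms(1) indep_var_distribution_eq by auto
  interpret Z: prob_space "distr M T Z" by (rule prob_space_distr) measurable
  have "(\<integral>\<^sup>+\<omega>. f (Y \<omega>, Z \<omega>) \<partial>M) = (\<integral>\<^sup>+x. f x \<partial>(distr M S Y \<Otimes>\<^sub>M distr M T Z))"
    unfolding eq by (simp add: nn_integral_distr)
  also have "\<dots> = (\<integral>\<^sup>+y. (\<integral>\<^sup>+z. f (y, z) \<partial>distr M T Z) \<partial>distr M S Y)"
    by (rule Z.nn_integral_fst[symmetric]) (simp cong: measurable_cong_sets)
  also have "\<dots> = (\<integral>\<^sup>+\<omega>. (\<integral>\<^sup>+z. f (Y \<omega>, z) \<partial>distr M T Z) \<partial>M)"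
    by (subst nn_integral_distr) auto
  also have "\<dots> = (\<integral>\<^sup>+\<omega>. (\<integral>\<^sup>+\<omega>'. f (Y \<omega>, Z \<omega>') \<partial>M) \<partial>M)"
    by (intro nn_integral_cong) (simp add: nn_integral_distr measurable_space)
  finally show ?thesis .
qed

text \<open>Exponential tilting: the damping turns the density of rate 1 into
  \<open>1 / (1 + c)\<close> times the density of rate \<open>1 + c\<close>, whose total mass is
  1.\<close>

lemma (in prob_space) nn_integral_exp_exponential:
  assumes D: "distributed M lborel G (exponential_density 1)" and "0 \<le> c"
  shows "(\<integral>\<^sup>+\<omega>. ennreal (exp (- (c * G \<omega>))) \<partial>M) = ennreal (1 / (1 + c))"
proof -
  interpret E: prob_space "density lborel (exponential_density (1 + c))"
    using assms by (intro prob_space_exponential_density) simp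
  have one: "(\<integral>\<^sup>+x. ennreal (exponential_density (1 + c) x) \<partial>lborel) = 1"
    using E.emeasure_space_1 by (simp add: emeasure_density)
  have "(\<integral>\<^sup>+\<omega>. ennreal (exp (- (c * G \<omega>))) \<partial>M) =
      (\<integral>\<^sup>+x. ennreal (exponential_density 1 x) * ennreal (exp (- (c * x))) \<partial>lborel)"
    by (rule distributed_nn_integral[OF D, symmetric]) simp
  also have "\<dots> = (\<integral>\<^sup>+x. ennreal (1 / (1 + c)) * ennreal (exponential_density (1 + c) x) \<partial>lborel)"
  proof (intro nn_integral_cong)
    fix x :: real
    show "ennreal (exponential_density 1 x) * ennreal (exp (- (c * x))) =
        ennreal (1 / (1 + c)) * ennreal (exponential_density (1 + c) x)"
    proof (cases "x < 0")
      case False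
      have "exp (- x) * exp (- (c * x)) = 1 / (1 + c) * ((1 + c) * exp (- x * (1 + c)))"
        using assms by (simp add: mult_exp_exp distrib_left mult.commute)
      with False assms show ?thesis
        by (simp add: exponential_density_def flip: ennreal_mult')
    qed (simp add: exponential_density_def)
  qed
  also have "\<dots> = ennreal (1 / (1 + c))"
    using one by (simp add: nn_integral_cmult)
  finally show ?thesis .
qed

lemma Re_of_bool [simp]: "Re (of_bool b) = of_bool b"
  by (cases b) auto

lemma measurable_Re_component:
  "s \<in> Q \<Longrightarrow> (\<lambda>y. Re (y s)) \<in> borel_measurable (PiM Q (\<lambda>_. borel))"
  by (rule measurable_compose[OF measurable_component_singleton[of s Q "\<lambda>_. borel"] borel_measurable_Re])

locale rayleigh_network = prob_space \<Omega> for \<Omega> :: "'w measure" +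
  fixes X :: "nat \<Rightarrow> 'w \<Rightarrow> complex" and g :: "nat \<Rightarrow> nat \<Rightarrow> 'w \<Rightarrow> real" and act :: "nat \<Rightarrow> 'w \<Rightarrow> bool"
    and M :: nat and r0 rout \<theta> \<alpha> \<beta> snr p :: real
  assumes r0: "0 < r0" "r0 \<le> rout" and \<alpha>: "0 < \<alpha>" and \<beta>: "0 < \<beta>" and snr: "0 < snr" and p: "0 \<le> p" "p \<le> 1"
    and X_rv: "\<And>i. i \<in> {1..M} \<Longrightarrow> X i \<in> borel_measurable \<Omega>"
    and X_distr: "\<And>i. i \<in> {1..M} \<Longrightarrow> distr \<Omega> borel (X i) = uniform_measure lborel (cball 0 rout)"
    and g_distr: "\<And>i j. i \<in> {0..M} \<Longrightarrow> j \<in> {1, 2} \<Longrightarrow> distributed \<Omega> lborel (g i j) (exponential_density 1)"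
    and act_rv: "\<And>i. i \<in> {1..M} \<Longrightarrow> act i \<in> measurable \<Omega> (count_space UNIV)"
    and act_distr: "\<And>i. i \<in> {1..M} \<Longrightarrow> distr \<Omega> (count_space UNIV) (act i) = measure_pmf (bernoulli_pmf p)"
    and indep: "indep_sets (source_events \<Omega> X g act) (sources M)"
begin

text \<open>All sources are embedded in one value type, so that the library's \<^const>\<open>prob_space.indep_vars\<close>
  applies to the whole family.\<close>

primrec source_var :: "source \<Rightarrow> 'w \<Rightarrow> complex" where
  "source_var (Pos i) = X i"
| "source_var (Fading i j) = (\<lambda>\<omega>. complex_of_real (g i j \<omega>))"
| "source_var (Access i) = (\<lambda>\<omega>. of_bool (act i \<omega>))"

lemma g_rv: "i \<in> {0..M} \<Longrightarrow> j \<in> {1, 2} \<Longrightarrow> g i j \<in> borel_measurable \<Omega>"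
  using distributed_measurable[OF g_distr] by simp

lemma g_nonneg: "i \<in> {0..M} \<Longrightarrow> j \<in> {1, 2} \<Longrightarrow> AE \<omega> in \<Omega>. 0 \<le> g i j \<omega>"
  using distributed_AE2[OF g_distr, of i j "\<lambda>x. 0 \<le> x"]
  by (auto simp: exponential_density_def)

lemma source_var_rv: "s \<in> sources M \<Longrightarrow> source_var s \<in> borel_measurable \<Omega>"
proof (cases s)
  case (Access i)
  assume "s \<in> sources M"
  then have "act i \<in> measurable \<Omega> (count_space UNIV)" using act_rv Access by (auto simp: sources_def)
  then show ?thesis using Access by (auto intro: measurable_compose)
qed (use X_rv g_rv in \<open>auto simp: sources_def\<close>)

text \<open>The embeddings into the complex numbers are measurable, so they can only shrink the
  families of generated events, and independence passes to smaller families.\<close>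

lemma indep_source_var: "indep_vars (\<lambda>_. borel) source_var (sources M)"
  unfolding indep_vars_def2
proof
  show "\<forall>s\<in>sources M. random_variable borel (source_var s)" using source_var_rv by blast
  show "indep_sets (\<lambda>s. {source_var s -` A \<inter> space \<Omega> |A. A \<in> sets borel}) (sources M)"
  proof (rule indep_sets_mono_sets[OF indep])
    fix s assume "s \<in> sources M"
    show "{source_var s -` A \<inter> space \<Omega> |A. A \<in> sets borel} \<subseteq> source_events \<Omega> X g act s"
    proof (cases s)
      case (Fading i j)
      have "complex_of_real -` A \<in> sets borel" if "A \<in> sets borel" for A
        using measurable_sets[OF _ that, of complex_of_real borel] by simp
      moreover have "source_var s -` A \<inter> space \<Omega> = g i j -` (complex_of_real -` A) \<inter> space \<Omega>" for A
        by (auto simp: Fading)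
      ultimately show ?thesis by (auto simp: Fading)
    next
      case (Access i)
      have *: "source_var s -` A \<inter> space \<Omega> = act i -` {b. of_bool b \<in> A} \<inter> space \<Omega>" for A
        by (auto simp: Access)
      have s: "source_events \<Omega> X g act s = {act i -` A \<inter> space \<Omega> |A. A \<in> sets (count_space UNIV)}"
        by (simp only: Access source_events.simps)
      show ?thesis
      proof
        fix E assume "E \<in> {source_var s -` A \<inter> space \<Omega> |A. A \<in> sets borel}"
        then obtain A where "E = source_var s -` A \<inter> space \<Omega>" by blast
        then have "E = act i -` {b. of_bool b \<in> A} \<inter> space \<Omega>" by (simp only: *)
        then show "E \<in> source_events \<Omega> X g act s"
          unfolding s by (intro CollectI exI[of _ "{b. of_bool b \<in> A}"]) simp
      qed
    qed auto
  qed
qed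

text \<open>A silent interferer contributes \<open>exp 0 = 1\<close>, an active one the Laplace
  transform of its gain; the access probability weighs the two.\<close>

lemma nn_integral_exp_interference:
  assumes i: "i \<in> {1..M}" and j: "j \<in> {1, 2}" and c: "0 \<le> c"
  shows "(\<integral>\<^sup>+\<omega>. ennreal (exp (- (c * (of_bool (act i \<omega>) * g i j \<omega>)))) \<partial>\<Omega>) = ennreal (1 - p + p / (1 + c))"
proof -
  have i': "i \<in> {0..M}" using i by simp
  have "indep_var (PiM {Access i} (\<lambda>_. borel)) (\<lambda>\<omega>. \<lambda>s\<in>{Access i}. source_var s \<omega>)
     (PiM {Fading i j} (\<lambda>_. borel)) (\<lambda>\<omega>. \<lambda>s\<in>{Fading i j}. source_var s \<omega>)"
    by (rule indep_var_restrict[OF indep_source_var]) (use i j in \<open>auto simp: sources_def\<close>)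
  from indep_var_nn_integral[OF this, of "\<lambda>(y, z). ennreal (exp (- (c * (Re (y (Access i)) * Re (z (Fading i j))))))"]
  have "(\<integral>\<^sup>+\<omega>. ennreal (exp (- (c * (of_bool (act i \<omega>) * g i j \<omega>)))) \<partial>\<Omega>) =
     (\<integral>\<^sup>+\<omega>. (\<integral>\<^sup>+\<omega>'. ennreal (exp (- (c * (of_bool (act i \<omega>) * g i j \<omega>')))) \<partial>\<Omega>) \<partial>\<Omega>)"
    by simp
  also have "\<dots> = (\<integral>\<^sup>+\<omega>. ennreal (if act i \<omega> then 1 / (1 + c) else 1) \<partial>\<Omega>)"
    using nn_integral_exp_exponential[OF g_distr[OF i' j] c]
    by (intro nn_integral_cong) (simp add: emeasure_space_1)
  also have "\<dots> = (\<integral>\<^sup>+b. ennreal (if b then 1 / (1 + c) else 1) \<partial>distr \<Omega> (count_space UNIV) (act i))"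
    using act_rv[OF i] by (simp add: nn_integral_distr)
  also have "\<dots> = ennreal (1 / (1 + c)) * ennreal p + ennreal (1 - p)"
    unfolding act_distr[OF i] using p by simp
  also have "\<dots> = ennreal (1 - p + p / (1 + c))"
    using p c by (simp add: add.commute flip: ennreal_mult' ennreal_plus)
  finally show ?thesis .
qed

text \<open>Since the fading gain of the reference transmitter is exponential, integrating it out first turns
  the threshold event into a product of exponentials in the interference terms.\<close>

lemma success_prob_frozen:
  assumes j: "j \<in> {1, 2}" and w: "\<And>i. i \<in> {1..M} \<Longrightarrow> 0 \<le> w i"
  shows "(\<integral>\<^sup>+\<omega>. indicator {\<beta><..} (g 0 j \<omega> / (1 / snr + (\<Sum>i=1..M. of_bool (act i \<omega>) * g i j \<omega> * w i))) \<partial>\<Omega>) =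
     ennreal (exp (- (\<beta> / snr)) * (\<Prod>i=1..M. (1 - p + p / (1 + \<beta> * w i))))"
proof -
  define T where "T = (\<lambda>\<omega>. 1 / snr + (\<Sum>i=1..M. of_bool (act i \<omega>) * g i j \<omega> * w i))"
  \<comment> \<open>The sources that enter the threshold. \<open>Fading 0 j\<close> is not among
    them, which makes the reference gain independent of the threshold.\<close>
  define Q where "Q = (\<lambda>i. Fading i j) ` {1..M} \<union> Access ` {1..M}"
  have j0: "0 \<in> {0..M}" by simp
  have ind: "indep_var (PiM Q (\<lambda>_. borel)) (\<lambda>\<omega>. \<lambda>s\<in>Q. source_var s \<omega>)
     (PiM {Fading 0 j} (\<lambda>_. borel)) (\<lambda>\<omega>. \<lambda>s\<in>{Fading 0 j}. source_var s \<omega>)"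
    by (rule indep_var_restrict[OF indep_source_var]) (use j in \<open>auto simp: sources_def Q_def\<close>)
  define t where "t = (\<lambda>y::source \<Rightarrow> complex. 1 / snr + (\<Sum>i=1..M. Re (y (Access i)) * Re (y (Fading i j)) * w i))"
  have t_meas [measurable]: "t \<in> borel_measurable (PiM Q (\<lambda>_. borel))"
    unfolding t_def
    by (intro borel_measurable_add borel_measurable_const borel_measurable_sum borel_measurable_times
        measurable_Re_component)
       (auto simp: Q_def)
  have tT: "t (\<lambda>s\<in>Q. source_var s \<omega>) = T \<omega>" for \<omega>
    unfolding t_def T_def by (intro arg_cong2[where f = "(+)"] refl sum.cong) (auto simp: Q_def)
  have "(\<integral>\<^sup>+\<omega>. indicator {\<beta><..} (g 0 j \<omega> / T \<omega>) \<partial>\<Omega>) =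
      (\<integral>\<^sup>+\<omega>. (\<integral>\<^sup>+\<omega>'. indicator {\<beta><..} (g 0 j \<omega>' / T \<omega>) \<partial>\<Omega>) \<partial>\<Omega>)"
    using indep_var_nn_integral[OF ind, of "\<lambda>(y, z). indicator {\<beta><..} (Re (z (Fading 0 j)) / t y)"]
    by (simp add: tT)
  also have "\<dots> = (\<integral>\<^sup>+\<omega>. ennreal (exp (- (\<beta> * T \<omega>))) \<partial>\<Omega>)"
  proof (rule nn_integral_cong_AE)
    \<comment> \<open>Gains are nonnegative only almost surely. This makes \<open>T\<close>
      positive, so the inequality can be multiplied out and the exponential tail formula
      applies.\<close>
    have "AE \<omega> in \<Omega>. \<forall>i\<in>{1..M}. 0 \<le> g i j \<omega>"
      using g_nonneg j by (intro AE_finite_allI) auto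
    then show "AE \<omega> in \<Omega>. (\<integral>\<^sup>+\<omega>'. indicator {\<beta><..} (g 0 j \<omega>' / T \<omega>) \<partial>\<Omega>) = ennreal (exp (- (\<beta> * T \<omega>)))"
    proof eventually_elim
      case (elim \<omega>)
      have "0 \<le> (\<Sum>i=1..M. of_bool (act i \<omega>) * g i j \<omega> * w i)"
        using elim w by (intro sum_nonneg) auto
      then have T: "0 < T \<omega>" unfolding T_def using snr by (simp add: add_pos_nonneg)
      have g0: "g 0 j \<in> borel_measurable \<Omega>" using g_rv j by simp
      have "(\<integral>\<^sup>+\<omega>'. indicator {\<beta><..} (g 0 j \<omega>' / T \<omega>) \<partial>\<Omega>) = (\<integral>\<^sup>+\<omega>'. indicator {\<omega>' \<in> space \<Omega>. \<beta> * T \<omega> < g 0 j \<omega>'} \<omega>' \<partial>\<Omega>)"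
        using T by (intro nn_integral_cong) (auto simp: indicator_def field_simps)
      also have "\<dots> = emeasure \<Omega> {\<omega>' \<in> space \<Omega>. \<beta> * T \<omega> < g 0 j \<omega>'}"
        using g0 by (intro nn_integral_indicator) measurable
      also have "\<dots> = ennreal (exp (- (\<beta> * T \<omega>)))"
        using exponential_distributedD_gt[OF g_distr[OF j0 j], of "\<beta> * T \<omega>"] T \<beta>
        by (simp add: emeasure_eq_measure)
      finally show ?case .
    qed
  qed
  also have "\<dots> = (\<integral>\<^sup>+\<omega>. ennreal (exp (- (\<beta> / snr))) *
      (\<Prod>i=1..M. ennreal (exp (- (\<beta> * w i * (of_bool (act i \<omega>) * g i j \<omega>))))) \<partial>\<Omega>)"
  proof (intro nn_integral_cong)
    fix \<omega>
    have "- (\<beta> * T \<omega>) = - (\<beta> / snr) + (\<Sum>i=1..M. - (\<beta> * w i * (of_bool (act i \<omega>) * g i j \<omega>)))"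
      by (simp add: T_def algebra_simps sum_distrib_left sum_negf)
    then show "ennreal (exp (- (\<beta> * T \<omega>))) = ennreal (exp (- (\<beta> / snr))) *
      (\<Prod>i=1..M. ennreal (exp (- (\<beta> * w i * (of_bool (act i \<omega>) * g i j \<omega>)))))"
      by (simp only: exp_add exp_sum[OF finite_atLeastAtMost] ennreal_mult'[OF exp_ge_zero] prod_ennreal[OF exp_ge_zero])
  qed
  also have "\<dots> = ennreal (exp (- (\<beta> / snr))) *
      (\<integral>\<^sup>+\<omega>. (\<Prod>i=1..M. ennreal (exp (- (\<beta> * w i * (of_bool (act i \<omega>) * g i j \<omega>))))) \<partial>\<Omega>)"
  proof (intro nn_integral_cmult borel_measurable_prod_ennreal)
    fix i assume "i \<in> {1..M}"
    then have [measurable]: "act i \<in> measurable \<Omega> (count_space UNIV)" "g i j \<in> borel_measurable \<Omega>"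
      using act_rv g_rv j by auto
    show "(\<lambda>\<omega>. ennreal (exp (- (\<beta> * w i * (of_bool (act i \<omega>) * g i j \<omega>))))) \<in> borel_measurable \<Omega>"
      by measurable
  qed
  also have "(\<integral>\<^sup>+\<omega>. (\<Prod>i=1..M. ennreal (exp (- (\<beta> * w i * (of_bool (act i \<omega>) * g i j \<omega>))))) \<partial>\<Omega>) =
      (\<Prod>i=1..M. (\<integral>\<^sup>+\<omega>. ennreal (exp (- (\<beta> * w i * (of_bool (act i \<omega>) * g i j \<omega>)))) \<partial>\<Omega>))"
  proof (rule indep_vars_nn_integral)
    \<comment> \<open>The blocks of different interferers share no source, so functions of them are
      independent.\<close>
    define K where "K = (\<lambda>i. {Access i, Fading i j})"
    have "indep_vars (\<lambda>i. PiM (K i) (\<lambda>_. borel)) (\<lambda>i \<omega>. \<lambda>s\<in>K i. source_var s \<omega>) {1..M}"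
      by (rule indep_vars_restrict[OF indep_source_var])
         (use j in \<open>auto simp: K_def sources_def disjoint_family_on_def\<close>)
    from indep_vars_compose2[OF this, of "\<lambda>i y. ennreal (exp (- (\<beta> * w i * (Re (y (Access i)) * Re (y (Fading i j))))))" "\<lambda>_. borel"]
    show "indep_vars (\<lambda>_. borel) (\<lambda>i \<omega>. ennreal (exp (- (\<beta> * w i * (of_bool (act i \<omega>) * g i j \<omega>))))) {1..M}"
      by (simp add: K_def)
  qed auto
  also have "\<dots> = (\<Prod>i=1..M. ennreal (1 - p + p / (1 + \<beta> * w i)))"
    using j w \<beta> by (intro prod.cong refl nn_integral_exp_interference) auto
  also have "\<dots> = ennreal (\<Prod>i=1..M. (1 - p + p / (1 + \<beta> * w i)))"
    using w \<beta> p by (intro prod_ennreal add_nonneg_nonneg divide_nonneg_nonneg) auto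
  finally show ?thesis by (simp add: T_def ennreal_mult')
qed

section \<open>Moments of the factor of one interferer\<close>

lemma disk_moments:
  assumes i: "i \<in> {1..M}" and Y: "norm Y = r0" and h_def: "h = (\<lambda>r. 1 / (1 + \<beta> * r powr (- \<alpha>)))"
  shows "(\<integral>\<omega>. h (norm (X i \<omega> - Y) / r0) \<partial>\<Omega>) =
      2 * r0\<^sup>2 / (pi * rout\<^sup>2) * (pi / \<beta> * Psi \<alpha> \<beta> ((rout - r0) / r0) + Z_fun \<alpha> \<beta> 1 rout r0)" (is ?A)
    and "(\<integral>\<omega>. (h (norm (X i \<omega> - Y) / r0))\<^sup>2 \<partial>\<Omega>) =
      2 * r0\<^sup>2 / (pi * rout\<^sup>2) * (pi * G_fun \<alpha> \<beta> ((rout - r0) / r0) + Z_fun \<alpha> \<beta> 2 rout r0)" (is ?B)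
proof -
  have den: "1 \<le> 1 + \<beta> * r powr (- \<alpha>)" for r using \<beta> by simp
  have h01: "0 \<le> h r" "h r \<le> 1" for r using den[of r] by (auto simp: h_def)
  have [measurable]: "h \<in> borel_measurable borel" unfolding h_def by measurable
  have mean: "(\<integral>\<omega>. f (norm (X i \<omega> - Y) / r0) \<partial>\<Omega>) = (\<integral>w. f (norm (w - Y) / r0) \<partial>uniform_measure lborel (cball 0 rout))"
    if [measurable]: "f \<in> borel_measurable borel" for f :: "real \<Rightarrow> real"
    unfolding X_distr[OF i, symmetric] using X_rv[OF i] by (subst integral_distr) auto
  \<comment> \<open>At \<open>r = 0\<close> this fails: \<open>0 powr (- \<alpha>) = 0\<close> gives
    \<open>h 0 = 1\<close>, the right side is 0. The weight \<open>r\<close> in the next two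
    identities hides the difference.\<close>
  have h_eq: "h r = r powr \<alpha> / (\<beta> + r powr \<alpha>)" if "0 < r" for r
    using that \<beta> by (simp add: h_def powr_minus field_simps)
  have 1: "r * h r = r powr (real 1 * \<alpha> + 1) / (\<beta> + r powr \<alpha>) ^ 1"
    and 2: "r * (h r)\<^sup>2 = r powr (real 2 * \<alpha> + 1) / (\<beta> + r powr \<alpha>) ^ 2" if "0 \<le> r" for r
  proof -
    have "2 * \<alpha> + 1 = \<alpha> + \<alpha> + 1" by simp
    then have "r powr (\<alpha> + 1) = r * r powr \<alpha>" "r powr (2 * \<alpha> + 1) = r * (r powr \<alpha>)\<^sup>2"
      using that by (simp_all only: powr_add power2_eq_square) (simp_all add: powr_one)
    then show "r * h r = r powr (real 1 * \<alpha> + 1) / (\<beta> + r powr \<alpha>) ^ 1"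
      "r * (h r)\<^sup>2 = r powr (real 2 * \<alpha> + 1) / (\<beta> + r powr \<alpha>) ^ 2"
      using that h_eq[of r] by (cases "r = 0"; simp add: power_divide)+
  qed
  have x1: "0 \<le> (rout - r0) / r0" using r0 by simp
  have Z: "integral {(rout - r0) / r0..(rout + r0) / r0}
      (\<lambda>r. r * h r * arccos ((r0\<^sup>2 * r\<^sup>2 + r0\<^sup>2 - rout\<^sup>2) / (2 * r0\<^sup>2 * r))) = Z_fun \<alpha> \<beta> 1 rout r0"
    "integral {(rout - r0) / r0..(rout + r0) / r0}
      (\<lambda>r. r * (h r)\<^sup>2 * arccos ((r0\<^sup>2 * r\<^sup>2 + r0\<^sup>2 - rout\<^sup>2) / (2 * r0\<^sup>2 * r))) = Z_fun \<alpha> \<beta> 2 rout r0"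
    unfolding Z_fun_def using x1 by (auto intro!: integral_cong simp only: 1 2 atLeastAtMost_iff)
  \<comment> \<open>\<open>Psi\<close> has its denominator divided by \<open>\<beta>\<close>; this
    is where the coefficient \<open>pi / \<beta>\<close> in \<open>S_fun\<close> comes from.\<close>
  have "integral {0..(rout - r0) / r0} (\<lambda>r. r * h r) =
      integral {0..(rout - r0) / r0} (\<lambda>r. inverse \<beta> * (r powr (\<alpha> + 1) / (1 + r powr \<alpha> * inverse \<beta>)))"
    using \<beta> by (intro integral_cong) (auto simp: 1 field_simps)
  then have P: "integral {0..(rout - r0) / r0} (\<lambda>r. r * h r) = inverse \<beta> * Psi \<alpha> \<beta> ((rout - r0) / r0)"
    unfolding Psi_def integral_mult_right .
  have G: "integral {0..(rout - r0) / r0} (\<lambda>r. r * (h r)\<^sup>2) = G_fun \<alpha> \<beta> ((rout - r0) / r0)"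
    unfolding G_fun_def by (intro integral_cong) (auto simp: 2)
  show ?A
    unfolding mean[OF \<open>h \<in> borel_measurable borel\<close>]
      integral_uniform_disk_radial[OF Y r0 \<open>h \<in> borel_measurable borel\<close> h01] Z P
    by (simp add: divide_inverse)
  have "(h r)\<^sup>2 \<le> 1" for r using h01[of r] by (simp add: power_le_one)
  then show ?B
    using mean[of "\<lambda>r. (h r)\<^sup>2"] integral_uniform_disk_radial[OF Y r0, of "\<lambda>r. (h r)\<^sup>2"]
    by (simp add: Z G)
qed

text \<open>The mean over the access indicator of interferer \<open>i\<close> and its fading gain, at normalized
  distance \<open>r\<close>.\<close>

definition link_factor :: "real \<Rightarrow> real" where
  "link_factor r = 1 - p + p / (1 + \<beta> * r powr (- \<alpha>))"

lemma measurable_link_factor [measurable]: "link_factor \<in> borel_measurable borel"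
  unfolding link_factor_def by measurable

lemma link_factor_bounds: "0 \<le> link_factor r" "link_factor r \<le> 1"
proof -
  have "1 \<le> 1 + \<beta> * r powr (- \<alpha>)" using \<beta> by simp
  then have "0 \<le> p / (1 + \<beta> * r powr (- \<alpha>))" "p / (1 + \<beta> * r powr (- \<alpha>)) \<le> p"
    using p mult_left_mono[of 1 "1 + \<beta> * r powr (- \<alpha>)" p] by (auto simp: divide_le_eq)
  then show "0 \<le> link_factor r" "link_factor r \<le> 1"
    using p by (auto simp: link_factor_def)
qed

lemma norm_receiver: "norm (receiver r0 \<theta> j) = r0"
  using r0 by (simp add: receiver_def norm_mult)

lemma norm_dist_rv: "i \<in> {1..M} \<Longrightarrow> norm_dist r0 \<theta> X i j \<in> borel_measurable \<Omega>"
  unfolding norm_dist_def[abs_def] using X_rv by measurable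

text \<open>The factor is the mixture \<open>(1 - p) + p * H\<close>, and the three terms of its
  square are the three summands of \<open>S_fun\<close>; the cross term doubles
  \<open>2 * r0\<^sup>2\<close> to \<open>4 * r0\<^sup>2\<close>.\<close>

lemma link_factor_second_moment:
  assumes i: "i \<in> {1..M}"
  shows "(\<integral>\<omega>. (link_factor (norm_dist r0 \<theta> X i j \<omega>))\<^sup>2 \<partial>\<Omega>) = S_fun \<alpha> \<beta> p rout r0"
proof -
  define h where "h = (\<lambda>r. 1 / (1 + \<beta> * r powr (- \<alpha>)))"
  define H where "H = (\<lambda>\<omega>. h (norm_dist r0 \<theta> X i j \<omega>))"
  have den: "1 \<le> 1 + \<beta> * r powr (- \<alpha>)" for r using \<beta> by simp
  have h01: "0 \<le> h r" "h r \<le> 1" for r using den[of r] by (auto simp: h_def)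
  have [measurable]: "h \<in> borel_measurable borel" unfolding h_def by measurable
  have [measurable]: "H \<in> borel_measurable \<Omega>" unfolding H_def using norm_dist_rv[OF i] by measurable
  have HB: "0 \<le> H \<omega>" "H \<omega> \<le> 1" for \<omega> using h01 by (auto simp: H_def)
  have int: "integrable \<Omega> H" "integrable \<Omega> (\<lambda>\<omega>. (H \<omega>)\<^sup>2)"
    using HB by (auto intro!: integrable_const_bound[of _ 1] simp: power_le_one)
  have "(link_factor (norm_dist r0 \<theta> X i j \<omega>))\<^sup>2 = (1 - p)\<^sup>2 + 2 * p * (1 - p) * H \<omega> + p\<^sup>2 * (H \<omega>)\<^sup>2" for \<omega>
  proof -
    have "link_factor (norm_dist r0 \<theta> X i j \<omega>) = (1 - p) + p * H \<omega>"
      by (simp add: link_factor_def H_def h_def)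
    then show ?thesis by (simp only: power2_eq_square) (simp add: algebra_simps)
  qed
  then have "(\<integral>\<omega>. (link_factor (norm_dist r0 \<theta> X i j \<omega>))\<^sup>2 \<partial>\<Omega>) =
      (1 - p)\<^sup>2 + 2 * p * (1 - p) * (\<integral>\<omega>. H \<omega> \<partial>\<Omega>) + p\<^sup>2 * (\<integral>\<omega>. (H \<omega>)\<^sup>2 \<partial>\<Omega>)"
    using int by (simp add: prob_space)
  also have "\<dots> = S_fun \<alpha> \<beta> p rout r0"
  proof -
    have 1: "2 * p * (1 - p) * (2 * r0\<^sup>2 / A * B) = 4 * r0\<^sup>2 / A * (1 - p) * p * B"
      and 2: "p\<^sup>2 * (2 * r0\<^sup>2 / A * B) = 2 * r0\<^sup>2 * p\<^sup>2 / A * B" for A B :: real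
      by (simp_all add: mult_ac)
    show ?thesis
      unfolding H_def norm_dist_def disk_moments[OF i norm_receiver h_def] S_fun_def Let_def 1 2 ..
  qed
  finally show ?thesis .
qed

text \<open>A version of the conditional success probability given the distances, as
  \<open>outage_eq\<close> confirms.\<close>

definition success_prob :: "nat \<Rightarrow> 'w \<Rightarrow> real" where
  "success_prob j \<omega> = exp (- (\<beta> / snr)) * (\<Prod>i=1..M. link_factor (norm_dist r0 \<theta> X i j \<omega>))"

lemma success_prob_bounds: "0 \<le> success_prob j \<omega>" "success_prob j \<omega> \<le> 1"
proof -
  have "(\<Prod>i=1..M. link_factor (norm_dist r0 \<theta> X i j \<omega>)) \<le> 1"
    by (intro prod_le_1) (auto simp: link_factor_bounds)
  moreover have "exp (- (\<beta> / snr)) \<le> 1" using \<beta> snr by simp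
  ultimately show "0 \<le> success_prob j \<omega>" "success_prob j \<omega> \<le> 1"
    by (auto simp: success_prob_def link_factor_bounds prod_nonneg intro!: mult_le_one)
qed

lemma success_prob_rv [measurable]: "success_prob j \<in> borel_measurable \<Omega>"
  unfolding success_prob_def[abs_def] using norm_dist_rv
  by (intro borel_measurable_times borel_measurable_const borel_measurable_prod
      measurable_compose[OF _ measurable_link_factor]) auto

text \<open>The \<open>i\<close>-th squared factor depends on the position of interferer
  \<open>i\<close> alone, so the mean of the product is a product of \<open>M\<close> equal
  means.\<close>

lemma success_prob_second_moment:
  "(\<integral>\<omega>. (success_prob j \<omega>)\<^sup>2 \<partial>\<Omega>) = exp (- (2 * \<beta> / snr)) * S_fun \<alpha> \<beta> p rout r0 ^ M"
proof -
  define L where "L = (\<lambda>i \<omega>. (link_factor (norm_dist r0 \<theta> X i j \<omega>))\<^sup>2)"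
  have rv: "L i \<in> borel_measurable \<Omega>" if "i \<in> {1..M}" for i
    unfolding L_def using norm_dist_rv[OF that] by measurable
  have "indep_vars (\<lambda>i. PiM {Pos i} (\<lambda>_. borel)) (\<lambda>i \<omega>. \<lambda>s\<in>{Pos i}. source_var s \<omega>) {1..M}"
    by (rule indep_vars_restrict[OF indep_source_var])
       (auto simp: sources_def disjoint_family_on_def)
  from indep_vars_compose2[OF this, of "\<lambda>i y. (link_factor (norm (y (Pos i) - receiver r0 \<theta> j) / r0))\<^sup>2" "\<lambda>_. borel"]
  have "indep_vars (\<lambda>_. borel) L {1..M}"
    by (simp add: L_def norm_dist_def)
  then have "(\<integral>\<omega>. (\<Prod>i=1..M. L i \<omega>) \<partial>\<Omega>) = (\<Prod>i=1..M. \<integral>\<omega>. L i \<omega> \<partial>\<Omega>)"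
  proof (rule indep_vars_lebesgue_integral[rotated])
    show "integrable \<Omega> (L i)" if "i \<in> {1..M}" for i
      using rv[OF that] link_factor_bounds
      by (auto intro!: integrable_const_bound[of _ 1] simp: L_def power_le_one)
  qed simp
  also have "\<dots> = S_fun \<alpha> \<beta> p rout r0 ^ M"
    unfolding L_def by (simp add: link_factor_second_moment)
  finally have "(\<integral>\<omega>. (\<Prod>i=1..M. L i \<omega>) \<partial>\<Omega>) = S_fun \<alpha> \<beta> p rout r0 ^ M" .
  moreover have "(success_prob j \<omega>)\<^sup>2 = exp (- (2 * \<beta> / snr)) * (\<Prod>i=1..M. L i \<omega>)" for \<omega>
    unfolding success_prob_def L_def power_mult_distrib prod_power_distrib
    by (simp flip: exp_double)
  ultimately show ?thesis by simp
qed

section \<open>Conditioning on the vector of distances\<close>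

definition dist_vec :: "'w \<Rightarrow> nat \<times> nat \<Rightarrow> real" where
  "dist_vec \<omega> = (\<lambda>(i, j)\<in>{1..M} \<times> {1, 2}. norm_dist r0 \<theta> X i j \<omega>)"

abbreviation dist_space :: "(nat \<times> nat \<Rightarrow> real) measure" where
  "dist_space \<equiv> Pi\<^sub>M ({1..M} \<times> {1, 2}) (\<lambda>_. borel)"

lemma dist_vec_rv: "dist_vec \<in> measurable \<Omega> dist_space"
  unfolding dist_vec_def[abs_def]
  by (rule measurable_restrict) (use norm_dist_rv in auto)

lemma dist_algebra_eq: "dist_algebra \<Omega> r0 \<theta> X M = vimage_algebra (space \<Omega>) dist_vec dist_space"
  unfolding dist_algebra_def dist_vec_def[abs_def] ..

lemma subalgebra_dist: "subalgebra \<Omega> (dist_algebra \<Omega> r0 \<theta> X M)"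
  unfolding subalgebra_def dist_algebra_eq
  using measurable_space[OF dist_vec_rv] measurable_sets[OF dist_vec_rv] by (auto simp: sets_vimage_algebra2)

lemma measurable_success_prob_dist: "success_prob j \<in> borel_measurable (dist_algebra \<Omega> r0 \<theta> X M)"
  if j: "j \<in> {1, 2}"
proof -
  have "(\<lambda>d. exp (- (\<beta> / snr)) * (\<Prod>i=1..M. link_factor (d (i, j)))) \<in> borel_measurable dist_space"
    by (intro borel_measurable_times borel_measurable_const borel_measurable_prod
        measurable_compose[OF measurable_component_singleton[of _ _ "\<lambda>_. borel"] measurable_link_factor]) (use j in auto)
  moreover have "dist_vec \<in> measurable (dist_algebra \<Omega> r0 \<theta> X M) dist_space"
    unfolding dist_algebra_eq using measurable_space[OF dist_vec_rv]
    by (intro measurable_vimage_algebra1) auto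
  ultimately have "(\<lambda>\<omega>. exp (- (\<beta> / snr)) * (\<Prod>i=1..M. link_factor (dist_vec \<omega> (i, j)))) \<in>
      borel_measurable (dist_algebra \<Omega> r0 \<theta> X M)"
    by (rule measurable_compose[rotated])
  moreover have "success_prob j = (\<lambda>\<omega>. exp (- (\<beta> / snr)) * (\<Prod>i=1..M. link_factor (dist_vec \<omega> (i, j))))"
    using j by (auto simp: success_prob_def dist_vec_def fun_eq_iff)
  ultimately show ?thesis by simp
qed

abbreviation SINR :: "nat \<Rightarrow> 'w \<Rightarrow> real" where
  "SINR \<equiv> sinr snr \<alpha> r0 \<theta> X g act M"

lemma sinr_rv:
  assumes j: "j \<in> {1, 2}"
  shows "SINR j \<in> borel_measurable \<Omega>"
proof -
  have [measurable]: "g 0 j \<in> borel_measurable \<Omega>" using g_rv j by simp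
  have "(\<lambda>\<omega>. of_bool (act i \<omega>) * g i j \<omega> * norm_dist r0 \<theta> X i j \<omega> powr (- \<alpha>)) \<in> borel_measurable \<Omega>"
    if "i \<in> {1..M}" for i
  proof -
    have [measurable]: "act i \<in> measurable \<Omega> (count_space UNIV)" "g i j \<in> borel_measurable \<Omega>"
      "norm_dist r0 \<theta> X i j \<in> borel_measurable \<Omega>"
      using act_rv g_rv norm_dist_rv that j by auto
    show ?thesis by measurable
  qed
  then show ?thesis
    unfolding sinr_def[abs_def] by (intro borel_measurable_divide borel_measurable_add borel_measurable_sum) auto
qed

text \<open>Positions on one side, gains and access indicators on the other, are disjoint blocks of
  sources. Freezing the positions makes the path losses constants, the situation of
  \<open>success_prob_frozen\<close>, and lets the indicator of \<open>C\<close> out of the inner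
  integral.\<close>

lemma nn_integral_success_given_dist:
  assumes j: "j \<in> {1, 2}" and C: "C \<in> sets dist_space"
  shows "(\<integral>\<^sup>+\<omega>. indicator C (dist_vec \<omega>) * indicator {\<beta><..} (SINR j \<omega>) \<partial>\<Omega>) =
    (\<integral>\<^sup>+\<omega>. indicator C (dist_vec \<omega>) * ennreal (success_prob j \<omega>) \<partial>\<Omega>)"
proof -
  define P where "P = Pos ` {1..M}"
  define Q where "Q = (\<lambda>i. Fading i j) ` {0..M} \<union> Access ` {1..M}"
  define Y where "Y = (\<lambda>\<omega>. \<lambda>s\<in>P. source_var s \<omega>)"
  define Z where "Z = (\<lambda>\<omega>. \<lambda>s\<in>Q. source_var s \<omega>)"
  let ?BP = "PiM P (\<lambda>_. borel) :: (source \<Rightarrow> complex) measure"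
  let ?BQ = "PiM Q (\<lambda>_. borel) :: (source \<Rightarrow> complex) measure"
  have ind: "indep_var ?BP Y ?BQ Z"
    unfolding Y_def Z_def
    by (rule indep_var_restrict[OF indep_source_var]) (use j in \<open>auto simp: sources_def P_def Q_def\<close>)
  \<comment> \<open>The distances as functions of the position block only; restricted to the index
    set they give \<open>dist_vec\<close>.\<close>
  define d where "d = (\<lambda>y::source \<Rightarrow> complex. \<lambda>(i, k). norm (y (Pos i) - receiver r0 \<theta> k) / r0)"
  define S where "S = (\<lambda>y z::source \<Rightarrow> complex. Re (z (Fading 0 j)) /
     (1 / snr + (\<Sum>i=1..M. Re (z (Access i)) * Re (z (Fading i j)) * d y (i, j) powr (- \<alpha>))))"
  have d_rv: "(\<lambda>y. d y (i, k)) \<in> borel_measurable ?BP" if "i \<in> {1..M}" for i k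
  proof -
    have [measurable]: "(\<lambda>y. y (Pos i)) \<in> measurable ?BP borel"
      by (rule measurable_component_singleton[of _ _ "\<lambda>_. borel"]) (use that in \<open>auto simp: P_def\<close>)
    show ?thesis unfolding d_def by simp
  qed
  have D [measurable]: "(\<lambda>y. restrict (d y) ({1..M} \<times> {1, 2})) \<in> measurable ?BP dist_space"
    by (rule measurable_restrict) (use d_rv in auto)
  have S [measurable]: "(\<lambda>(y, z). S y z) \<in> borel_measurable (?BP \<Otimes>\<^sub>M ?BQ)"
  proof -
    have z: "(\<lambda>x. Re (snd x s)) \<in> borel_measurable (?BP \<Otimes>\<^sub>M ?BQ)" if "s \<in> Q" for s
      by (rule measurable_compose[OF measurable_snd measurable_Re_component[OF that]])
    have y: "(\<lambda>x. d (fst x) (i, j) powr (- \<alpha>)) \<in> borel_measurable (?BP \<Otimes>\<^sub>M ?BQ)" if "i \<in> {1..M}" for i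
      using measurable_compose[OF measurable_fst d_rv[OF that, of j]] by measurable
    show ?thesis
      unfolding S_def split_beta
      by (intro borel_measurable_divide borel_measurable_add borel_measurable_const borel_measurable_sum
          borel_measurable_times z y) (auto simp: Q_def)
  qed
  have dY: "restrict (d (Y \<omega>)) ({1..M} \<times> {1, 2}) = dist_vec \<omega>" for \<omega>
    by (auto simp: d_def Y_def P_def dist_vec_def norm_dist_def fun_eq_iff)
  have dYj: "d (Y \<omega>) (i, j) = norm_dist r0 \<theta> X i j \<omega>" if "i \<in> {1..M}" for i \<omega>
    using that by (simp add: d_def Y_def P_def norm_dist_def)
  have SYZ: "S (Y \<omega>) (Z \<omega>') = g 0 j \<omega>' /
      (1 / snr + (\<Sum>i=1..M. of_bool (act i \<omega>') * g i j \<omega>' * norm_dist r0 \<theta> X i j \<omega> powr (- \<alpha>)))" for \<omega> \<omega>'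
    unfolding S_def
    by (intro arg_cong2[where f = "(/)"] arg_cong2[where f = "(+)"] refl sum.cong)
       (auto simp: Z_def Q_def dYj)
  have "(\<integral>\<^sup>+\<omega>. indicator C (dist_vec \<omega>) * indicator {\<beta><..} (SINR j \<omega>) \<partial>\<Omega>) =
     (\<integral>\<^sup>+\<omega>. (\<lambda>(y, z). indicator C (restrict (d y) ({1..M} \<times> {1, 2})) * indicator {\<beta><..} (S y z)) (Y \<omega>, Z \<omega>) \<partial>\<Omega>)"
    by (simp only: prod.case dY SYZ sinr_def)
  also have "\<dots> = (\<integral>\<^sup>+\<omega>. (\<integral>\<^sup>+\<omega>'. (\<lambda>(y, z). indicator C (restrict (d y) ({1..M} \<times> {1, 2})) * indicator {\<beta><..} (S y z)) (Y \<omega>, Z \<omega>') \<partial>\<Omega>) \<partial>\<Omega>)"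
  proof (rule indep_var_nn_integral[OF ind])
    have "(\<lambda>x. indicator C (restrict (d (fst x)) ({1..M} \<times> {1, 2})) :: ennreal) \<in> borel_measurable (?BP \<Otimes>\<^sub>M ?BQ)"
      using C by (intro measurable_compose[OF measurable_compose[OF measurable_fst D]]) auto
    moreover have "(\<lambda>x. indicator {\<beta><..} (S (fst x) (snd x)) :: ennreal) \<in> borel_measurable (?BP \<Otimes>\<^sub>M ?BQ)"
      using S unfolding split_beta by (rule measurable_compose) auto
    ultimately show "(\<lambda>(y, z). indicator C (restrict (d y) ({1..M} \<times> {1, 2})) * indicator {\<beta><..} (S y z) :: ennreal)
        \<in> borel_measurable (?BP \<Otimes>\<^sub>M ?BQ)"
      unfolding split_beta by (rule borel_measurable_times_ennreal)
  qed
  also have "\<dots> = (\<integral>\<^sup>+\<omega>. indicator C (dist_vec \<omega>) * ennreal (success_prob j \<omega>) \<partial>\<Omega>)"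
  proof (intro nn_integral_cong)
    fix \<omega>
    have rv: "(\<lambda>\<omega>'. indicator {\<beta><..} (S (Y \<omega>) (Z \<omega>')) :: ennreal) \<in> borel_measurable \<Omega>"
    proof -
      have "Z \<in> measurable \<Omega> ?BQ" "Y \<omega> \<in> space ?BP"
        using indep_var_rv2[OF ind] by (auto simp: Y_def space_PiM)
      then have "(\<lambda>\<omega>'. (Y \<omega>, Z \<omega>')) \<in> measurable \<Omega> (?BP \<Otimes>\<^sub>M ?BQ)" by measurable
      from measurable_compose[OF this S] show ?thesis
        by (simp add: borel_measurable_indicator')
    qed
    show "(\<integral>\<^sup>+\<omega>'. (\<lambda>(y, z). indicator C (restrict (d y) ({1..M} \<times> {1, 2})) * indicator {\<beta><..} (S y z)) (Y \<omega>, Z \<omega>') \<partial>\<Omega>) =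
        indicator C (dist_vec \<omega>) * ennreal (success_prob j \<omega>)"
      using rv success_prob_frozen[OF j, of "\<lambda>i. norm_dist r0 \<theta> X i j \<omega> powr (- \<alpha>)"]
      by (simp add: dY nn_integral_cmult SYZ success_prob_def link_factor_def del: One_nat_def)
  qed
  finally show ?thesis .
qed

text \<open>A conditional expectation is identified by measurability and by its integrals over the
  events of the subalgebra. Every such event is a preimage under \<open>dist_vec\<close>, so the
  previous lemma settles them all.\<close>

lemma outage_eq:
  assumes j: "j \<in> {1, 2}"
  shows "AE \<omega> in \<Omega>. outage \<Omega> snr \<alpha> \<beta> r0 \<theta> X g act M j \<omega> = 1 - success_prob j \<omega>"
proof -
  interpret finite_measure_subalgebra \<Omega> "dist_algebra \<Omega> r0 \<theta> X M"
    by unfold_locales (rule subalgebra_dist)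
  note [measurable] = sinr_rv[OF j]
  let ?fail = "{\<omega> \<in> space \<Omega>. SINR j \<omega> \<le> \<beta>}"
  have [measurable]: "?fail \<in> events" by measurable
  show ?thesis
    unfolding outage_def
  proof (rule real_cond_exp_charact)
    fix A assume "A \<in> sets (dist_algebra \<Omega> r0 \<theta> X M)"
    then obtain C where C: "C \<in> sets dist_space" and A: "A = dist_vec -` C \<inter> space \<Omega>"
      unfolding dist_algebra_eq using measurable_space[OF dist_vec_rv] by (auto simp: sets_vimage_algebra2)
    have [measurable]: "A \<in> events" unfolding A using dist_vec_rv C by (rule measurable_sets)
    have "(\<integral>\<^sup>+\<omega>. ennreal (indicator A \<omega> * indicator {\<beta><..} (SINR j \<omega>)) \<partial>\<Omega>) =
      (\<integral>\<^sup>+\<omega>. indicator C (dist_vec \<omega>) * indicator {\<beta><..} (SINR j \<omega>) \<partial>\<Omega>)"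
      by (intro nn_integral_cong) (auto simp: A indicator_def)
    also have "\<dots> = (\<integral>\<^sup>+\<omega>. indicator C (dist_vec \<omega>) * ennreal (success_prob j \<omega>) \<partial>\<Omega>)"
      by (rule nn_integral_success_given_dist[OF j C])
    also have "\<dots> = (\<integral>\<^sup>+\<omega>. ennreal (indicator A \<omega> * success_prob j \<omega>) \<partial>\<Omega>)"
      by (intro nn_integral_cong) (auto simp: A indicator_def)
    finally have eq: "(\<integral>\<omega>. indicator A \<omega> * indicator {\<beta><..} (SINR j \<omega>) \<partial>\<Omega>) =
        (\<integral>\<omega>. indicator A \<omega> * success_prob j \<omega> \<partial>\<Omega>)"
      using success_prob_bounds by (simp add: integral_eq_nn_integral)
    have int: "integrable \<Omega> (\<lambda>\<omega>. indicator A \<omega> :: real)"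
      "integrable \<Omega> (\<lambda>\<omega>. indicator A \<omega> * indicator {\<beta><..} (SINR j \<omega>) :: real)"
      "integrable \<Omega> (\<lambda>\<omega>. indicator A \<omega> * success_prob j \<omega>)"
      using success_prob_bounds
      by (auto intro!: integrable_const_bound[of _ 1] simp: indicator_def)
    \<comment> \<open>Failure is the complement of the success event, so the identity already shown
      is subtracted from the mass of \<open>A\<close>.\<close>
    have "(\<integral>\<omega>\<in>A. (indicator ?fail \<omega> :: real) \<partial>\<Omega>) = (\<integral>\<omega>. indicator A \<omega> - indicator A \<omega> * indicator {\<beta><..} (SINR j \<omega>) \<partial>\<Omega>)"
      unfolding set_lebesgue_integral_def by (intro Bochner_Integration.integral_cong) (auto simp: indicator_def)
    also have "\<dots> = (\<integral>\<omega>. indicator A \<omega> - indicator A \<omega> * success_prob j \<omega> \<partial>\<Omega>)"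
      using int eq by (simp del: Bochner_Integration.integral_indicator)
    also have "\<dots> = (\<integral>\<omega>\<in>A. 1 - success_prob j \<omega> \<partial>\<Omega>)"
      unfolding set_lebesgue_integral_def by (intro Bochner_Integration.integral_cong) (auto simp: indicator_def)
    finally show "(\<integral>\<omega>\<in>A. indicator ?fail \<omega> \<partial>\<Omega>) = (\<integral>\<omega>\<in>A. 1 - success_prob j \<omega> \<partial>\<Omega>)" .
  next
    show "integrable \<Omega> (indicator ?fail :: 'w \<Rightarrow> real)"
      by (simp add: less_top[symmetric])
    show "integrable \<Omega> (\<lambda>\<omega>. 1 - success_prob j \<omega>)"
      using success_prob_bounds by (intro integrable_const_bound[of _ 1]) auto
    show "(\<lambda>\<omega>. 1 - success_prob j \<omega>) \<in> borel_measurable (dist_algebra \<Omega> r0 \<theta> X M)"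
      using measurable_success_prob_dist[OF j] by simp
  qed
qed

lemma outage_second_moment:
  assumes j: "j \<in> {1, 2}"
  shows "(\<integral>\<omega>. (outage \<Omega> snr \<alpha> \<beta> r0 \<theta> X g act M j \<omega>)\<^sup>2 \<partial>\<Omega>) =
        2 * (\<integral>\<omega>. outage \<Omega> snr \<alpha> \<beta> r0 \<theta> X g act M j \<omega> \<partial>\<Omega>) - 1
        + exp (- (2 * \<beta> / snr)) * S_fun \<alpha> \<beta> p rout r0 ^ M"
proof -
  have [measurable]: "outage \<Omega> snr \<alpha> \<beta> r0 \<theta> X g act M j \<in> borel_measurable \<Omega>"
    unfolding outage_def by simp
  have int: "integrable \<Omega> (success_prob j)" "integrable \<Omega> (\<lambda>\<omega>. (success_prob j \<omega>)\<^sup>2)"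
    using success_prob_bounds by (auto intro!: integrable_const_bound[of _ 1] simp: power_le_one)
  have "(\<integral>\<omega>. (outage \<Omega> snr \<alpha> \<beta> r0 \<theta> X g act M j \<omega>)\<^sup>2 \<partial>\<Omega>) = (\<integral>\<omega>. (1 - success_prob j \<omega>)\<^sup>2 \<partial>\<Omega>)"
    using outage_eq[OF j] by (intro integral_cong_AE) auto
  also have "\<dots> = (\<integral>\<omega>. 1 - 2 * success_prob j \<omega> + (success_prob j \<omega>)\<^sup>2 \<partial>\<Omega>)"
    by (simp add: power2_eq_square algebra_simps)
  also have "\<dots> = 1 - 2 * (\<integral>\<omega>. success_prob j \<omega> \<partial>\<Omega>) + (\<integral>\<omega>. (success_prob j \<omega>)\<^sup>2 \<partial>\<Omega>)"
    using int by (simp add: prob_space)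
  also have "(\<integral>\<omega>. (success_prob j \<omega>)\<^sup>2 \<partial>\<Omega>) = exp (- (2 * \<beta> / snr)) * S_fun \<alpha> \<beta> p rout r0 ^ M"
    by (rule success_prob_second_moment)
  finally have "(\<integral>\<omega>. (outage \<Omega> snr \<alpha> \<beta> r0 \<theta> X g act M j \<omega>)\<^sup>2 \<partial>\<Omega>) =
      1 - 2 * (\<integral>\<omega>. success_prob j \<omega> \<partial>\<Omega>) + exp (- (2 * \<beta> / snr)) * S_fun \<alpha> \<beta> p rout r0 ^ M" .
  moreover have "(\<integral>\<omega>. outage \<Omega> snr \<alpha> \<beta> r0 \<theta> X g act M j \<omega> \<partial>\<Omega>) = (\<integral>\<omega>. 1 - success_prob j \<omega> \<partial>\<Omega>)"
    using outage_eq[OF j] by (intro integral_cong_AE) auto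
  ultimately show ?thesis
    using int by (simp add: prob_space)
qed

end


theorem theorem2:
  fixes \<Omega> :: "'w measure"
    and X :: "nat \<Rightarrow> 'w \<Rightarrow> complex" and g :: "nat \<Rightarrow> nat \<Rightarrow> 'w \<Rightarrow> real" and act :: "nat \<Rightarrow> 'w \<Rightarrow> bool"
    and M :: nat and r0 rout \<theta> \<alpha> \<beta> snr p :: real
  assumes "prob_space \<Omega>"
    and "0 < r0" and "r0 \<le> rout" and "0 < \<alpha>" and "0 < \<beta>" and "0 < snr" and "0 \<le> p" and "p \<le> 1"
    and "\<And>i. i \<in> {1..M} \<Longrightarrow> X i \<in> borel_measurable \<Omega>"
    and "\<And>i. i \<in> {1..M} \<Longrightarrow> distr \<Omega> borel (X i) = uniform_measure lborel (cball 0 rout)"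
    and "\<And>i j. i \<in> {0..M} \<Longrightarrow> j \<in> {1, 2} \<Longrightarrow> distributed \<Omega> lborel (g i j) (exponential_density 1)"
    and "\<And>i. i \<in> {1..M} \<Longrightarrow> act i \<in> measurable \<Omega> (count_space UNIV)"
    and "\<And>i. i \<in> {1..M} \<Longrightarrow> distr \<Omega> (count_space UNIV) (act i) = measure_pmf (bernoulli_pmf p)"
    and "prob_space.indep_sets \<Omega> (source_events \<Omega> X g act) (sources M)"
  shows "(\<forall>j\<in>{1, 2}.
      (\<integral>\<omega>. (outage \<Omega> snr \<alpha> \<beta> r0 \<theta> X g act M j \<omega>)\<^sup>2 \<partial>\<Omega>) =
        2 * (\<integral>\<omega>. outage \<Omega> snr \<alpha> \<beta> r0 \<theta> X g act M j \<omega> \<partial>\<Omega>) - 1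
        + exp (- (2 * \<beta> / snr)) * S_fun \<alpha> \<beta> p rout r0 ^ M)
    \<and> (\<forall>x\<ge>0. complex_of_real (Psi \<alpha> \<beta> x) =
        complex_of_real (x powr (\<alpha> + 2) / (2 + \<alpha>)) *
        hyp2F1 1 (complex_of_real (2 / \<alpha> + 1)) (complex_of_real (2 / \<alpha> + 2))
          (complex_of_real (- (x powr \<alpha> / \<beta>))))
    \<and> (\<forall>x\<ge>0. complex_of_real (G_fun \<alpha> \<beta> x) =
        complex_of_real (x powr (2 * \<alpha> + 2) / ((2 + 2 * \<alpha>) * \<beta>\<^sup>2)) *
        hyp2F1 2 (complex_of_real ((2 + 2 * \<alpha>) / \<alpha>)) (complex_of_real ((2 + 3 * \<alpha>) / \<alpha>))
          (complex_of_real (- (x powr \<alpha> / \<beta>))))"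
proof -
  interpret rayleigh_network \<Omega> X g act M r0 rout \<theta> \<alpha> \<beta> snr p
    by (rule rayleigh_network.intro[OF assms(1)], unfold_locales) (use assms in auto)
  show ?thesis
    using outage_second_moment Psi_eq_hyp2F1 G_fun_eq_hyp2F1 assms(4,5) by blast
qed

end
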